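(* Let $m\in\mathbb N$ and let $f_1,\ldots,f_m$ be non-constant rational maps such that the rational semigroup $G=\langle f_1,\ldots,f_m\rangle$ is expanding. Let $\tilde f:J(\tilde f)\to J(\tilde f)$ be the associated skew product, let $p:J(\tilde f)\to\Sigma_m$ be a measurable map such that $\sigma\circ p=p\circ\tilde f$, and let $\mu$ be an $\tilde f$-invariant Borel probability measure on $J(\tilde f)$. If $\mathcal R_1$ and $\mathcal R_2$ are $\Pi$-adapted partitions of $J(\tilde f)$, then for $\mu$-a.e. $x\in J(\tilde f)$, $$h_{\Pi,p}(\tilde f,\mu,x,\mathcal R_1)=h_{\Pi,p}(\tilde f,\mu,x,\mathcal R_2).$$ In particular, $$h_{\Pi,p}(\tilde f,\mu,\mathcal R_1)=h_{\Pi,p}(\tilde f,\mu,\mathcal R_2).$$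
   Context: **Skew product and Julia sets.** $\widehat{\mathbb C}$ is the Riemann sphere with the spherical metric $d_{\widehat{\mathbb C}}$. $G=\langle f_1,\ldots,f_m\rangle$ is the semigroup generated by $f_1,\ldots,f_m$ under composition; its Julia set $J(G)$ is the set of $z\in\widehat{\mathbb C}$ such that $G$ is not normal on any neighbourhood of $z$. Let $\Sigma_m=\{1,\ldots,m\}^{\mathbb Z}$ with the shift map $\sigma:\Sigma_m\to\Sigma_m$. The skew product associated with $(f_1,\ldots,f_m)$ is $\tilde f:\Sigma_m\times\widehat{\mathbb C}\to\Sigma_m\times\widehat{\mathbb C}$, $\tilde f(\omega,z)=(\sigma\omega,f_{\omega_1}(z))$ for $\omega=(\ldots,\omega_0,\omega_1,\omega_2,\ldots)$. For $\omega\in\Sigma_m$, $J_\omega(\tilde f)$ is the set of $z\in\widehat{\mathbb C}$ such that $\{f_{\omega_n}\circ\cdots\circ f_{\omega_1}\}_{n\ge1}$ is not normal on any neighbourhood of $z$, and $J(\tilde f)=\overline{\bigcup_{\omega\in\Sigma_m}\{\omega\}\times J_\omega(\tilde f)}$ (closure in $\Sigma_m\times\widehat{\mathbb C}$). It is known that $\tilde f(J(\tilde f))=\tilde f^{-1}(J(\tilde f))=J(\tilde f)$; the restriction of $\tilde f$ to $J(\tilde f)$ is again denoted $\tilde f$. $\Pi$ is the second coordinate projection $\Sigma_m\times\widehat{\mathbb C}\to\widehat{\mathbb C}$, here restricted to $J(\tilde f)$. **Expanding.** $\|\varphi'(z)\|$ is the operator norm of the derivative of a holomorphic map $\varphi$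 at $z$ with respect to the spherical metric, and $\|(\tilde f^n)'(\omega,z)\|:=\|(f_{\omega_n}\circ\cdots\circ f_{\omega_1})'(z)\|$. $G$ is expanding if $J(G)\ne\emptyset$ and there are $C>0$, $\lambda>1$ with $\inf_{(\omega,z)\in J(\tilde f)}\|(\tilde f^n)'(\omega,z)\|\ge C\lambda^n$ for every $n\ge1$. **Entropy.** For a probability measure $\nu$, a countable measurable partition $\xi$ and a sub-$\sigma$-algebra $\mathcal A$, $I_\nu(\xi\mid\mathcal A)=-\sum_{A\in\xi}\mathbf 1_A\log E_\nu(\mathbf 1_A\mid\mathcal A)$ and $H_\nu(\xi\mid\mathcal A)=\int I_\nu(\xi\mid\mathcal A)\,d\nu$, where $E_\nu(\cdot\mid\mathcal A)$ is conditional expectation. $\mathcal B(\Delta)$ is the Borel $\sigma$-algebra of $\Delta$; $\gamma:=\mathcal B(\widehat{\mathbb C})$; $\mathcal I:=\{B\in\mathcal B(J(\tilde f)):\tilde f^{-1}B=B\}$; $\mathcal A_1\vee\mathcal A_2$ is the smallest $\sigma$-algebra containing $\mathcal A_1$ and $\mathcal A_2$. **$\Pi$-adapted partitions.** Let $[j]=\{\omega\in\Sigma_m:\omega_1=j\}$. A finite Borel partition $\mathcal R$ of $J(\tilde f)$ is $\Pi$-adapted if for any $R\in\mathcal R$ there exist $j\in\{1,\ldots,m\}$, a compact set $K_R\subset\widehat{\mathbb C}$ and an open set $U_R\subset\widehat{\mathbb C}$ such that $R\subset J(\tilde f)\cap([j]\times K_R)$, $K_R\subset U_R$, and $f_j$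 is injective on $U_R$. **Conditional projection entropy.** For a finite Borel partition $\mathcal R$ of $J(\tilde f)$, $$h_{\Pi,p}(\tilde f,\mu,\mathcal R)=H_\mu(\mathcal R\mid p^{-1}\mathcal B(\Sigma_m)\vee\tilde f^{-1}\Pi^{-1}\gamma)-H_\mu(\mathcal R\mid p^{-1}\mathcal B(\Sigma_m)\vee\Pi^{-1}\gamma),$$ $$h_{\Pi,p}(\tilde f,\mu,x,\mathcal R)=E_\mu\big(I_\mu(\mathcal R\mid p^{-1}\mathcal B(\Sigma_m)\vee\tilde f^{-1}\Pi^{-1}\gamma)-I_\mu(\mathcal R\mid p^{-1}\mathcal B(\Sigma_m)\vee\Pi^{-1}\gamma)\,\big|\,\mathcal I\big)(x).$$ *)

theory Defs
  imports
    "HOL-Complex_Analysis.Complex_Analysis"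
    "HOL-Probability.Probability"
begin

section \<open>The Riemann sphere\<close>

datatype riemann_sphere = Fin complex | Infty

fun stereographic :: "riemann_sphere \<Rightarrow> complex \<times> real" where
  "stereographic (Fin z) =
     ((2 / (1 + (cmod z)\<^sup>2)) *\<^sub>R z, ((cmod z)\<^sup>2 - 1) / ((cmod z)\<^sup>2 + 1))"
| "stereographic Infty = (0, 1)"

lemma norm_stereographic: "norm (stereographic x) = 1"
proof (cases x)
  case (Fin z)
  define s where "s = (cmod z)\<^sup>2"
  have s: "1 + s > 0" unfolding s_def by (smt (verit) zero_le_power2)
  have "(norm (stereographic x))\<^sup>2 = (2 / (1 + s))\<^sup>2 * s + ((s - 1) / (s + 1))\<^sup>2"
    using s by (simp add: Fin norm_Pair s_def power_mult_distrib power_divide)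
  also have "\<dots> = (4 * s + (s - 1)\<^sup>2) / (1 + s)\<^sup>2"
    by (simp add: power_divide add_divide_distrib add.commute)
  also have "4 * s + (s - 1)\<^sup>2 = (1 + s)\<^sup>2"
    by (simp add: power2_eq_square algebra_simps)
  finally have "(norm (stereographic x))\<^sup>2 = 1" using s by simp
  then show ?thesis by (simp add: power2_eq_1_iff) (smt (verit) norm_ge_zero)
qed (simp add: norm_Pair)

lemma stereographic_inject: "stereographic x = stereographic y \<longleftrightarrow> x = y"
proof
  have fin: "((cmod z)\<^sup>2 - 1) / ((cmod z)\<^sup>2 + 1) = 1 - 2 / (1 + (cmod z)\<^sup>2)"
    and pos: "1 + (cmod z)\<^sup>2 > 0" for z
  proof -
    show p: "1 + (cmod z)\<^sup>2 > 0" by (smt (verit) zero_le_power2)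
    then show "((cmod z)\<^sup>2 - 1) / ((cmod z)\<^sup>2 + 1) = 1 - 2 / (1 + (cmod z)\<^sup>2)"
      by (simp add: field_simps)
  qed
  assume eq: "stereographic x = stereographic y"
  show "x = y"
  proof (cases x; cases y)
    fix z w assume xy: "x = Fin z" "y = Fin w"
    then have 1: "2 / (1 + (cmod z)\<^sup>2) = 2 / (1 + (cmod w)\<^sup>2)"
      using eq fin[of z] fin[of w] by simp
    have 2: "2 / (1 + (cmod w)\<^sup>2) \<noteq> 0" using pos[of w] by simp
    have "(2 / (1 + (cmod w)\<^sup>2)) *\<^sub>R z = (2 / (1 + (cmod w)\<^sup>2)) *\<^sub>R w"
      using eq xy 1 by simp
    then show ?thesis using 2 xy by (metis scaleR_left_imp_eq)
  next
    fix z assume xy: "x = Fin z" "y = Infty"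
    then show ?thesis using eq fin[of z] pos[of z] by simp
  next
    fix z assume xy: "x = Infty" "y = Fin z"
    then show ?thesis using eq fin[of z] pos[of z] by simp
  qed auto
qed simp

lemma arccos_inner_triangle:
  fixes u v w :: "'a::real_inner"
  assumes [simp]: "norm u = 1" "norm v = 1" "norm w = 1"
  shows "arccos (u \<bullet> w) \<le> arccos (u \<bullet> v) + arccos (v \<bullet> w)"
proof -
  have b: "\<bar>a \<bullet> b\<bar> \<le> 1" if "norm a = 1" "norm b = 1" for a b :: 'a
    using Cauchy_Schwarz_ineq2[of a b] that by simp
  have bu: "\<bar>u \<bullet> v\<bar> \<le> 1" "\<bar>v \<bullet> w\<bar> \<le> 1" "\<bar>u \<bullet> w\<bar> \<le> 1" by (simp_all add: b)
  let ?A = "arccos (u \<bullet> v)" and ?B = "arccos (v \<bullet> w)"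
  have AB: "0 \<le> ?A" "?A \<le> pi" "0 \<le> ?B" "?B \<le> pi"
    using bu by (auto intro!: arccos_lbound arccos_ubound)
  show ?thesis
  proof (cases "?A + ?B \<le> pi")
    case True
    have nv: "v \<bullet> v = 1" "u \<bullet> u = 1" "w \<bullet> w = 1" by (simp_all flip: power2_norm_eq_inner)
    let ?x = "u - (u \<bullet> v) *\<^sub>R v" and ?y = "w - (v \<bullet> w) *\<^sub>R v"
    have nx: "norm ?x = sqrt (1 - (u \<bullet> v)\<^sup>2)"
      by (simp add: norm_eq_sqrt_inner inner_diff_left inner_diff_right nv
          inner_commute[of v u] power2_eq_square)
    have ny: "norm ?y = sqrt (1 - (v \<bullet> w)\<^sup>2)"
      by (simp add: norm_eq_sqrt_inner inner_diff_left inner_diff_right nv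
          inner_commute[of w v] power2_eq_square)
    have xy: "?x \<bullet> ?y = u \<bullet> w - (u \<bullet> v) * (v \<bullet> w)"
      by (simp add: inner_diff_left inner_diff_right nv inner_commute[of w v])
    have "cos (?A + ?B) = (u \<bullet> v) * (v \<bullet> w) - norm ?x * norm ?y"
      unfolding cos_add nx ny using bu by (simp add: cos_arccos_abs sin_arccos_abs)
    also have "\<dots> \<le> u \<bullet> w"
      using Cauchy_Schwarz_ineq2[of ?x ?y] xy by linarith
    finally have "cos (?A + ?B) \<le> u \<bullet> w" .
    then have "arccos (u \<bullet> w) \<le> arccos (cos (?A + ?B))"
      using bu by (intro arccos_le_arccos) auto
    then show ?thesis using True AB by (simp add: arccos_cos)
  next
    case False
    then show ?thesis using arccos_ubound[of "u \<bullet> w"] bu by linarith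
  qed
qed

text \<open>The spherical metric: great-circle distance, i.e. the Riemannian distance of
  \<open>2 |dz| / (1 + |z|\<^sup>2)\<close>.\<close>

instantiation riemann_sphere :: metric_space
begin

definition dist_riemann_sphere :: "riemann_sphere \<Rightarrow> riemann_sphere \<Rightarrow> real" where
  "dist_riemann_sphere x y = arccos (stereographic x \<bullet> stereographic y)"

definition uniformity_riemann_sphere :: "(riemann_sphere \<times> riemann_sphere) filter" where
  "uniformity_riemann_sphere = (INF e\<in>{0<..}. principal {(x, y). dist x y < e})"

definition open_riemann_sphere :: "riemann_sphere set \<Rightarrow> bool" where
  "open_riemann_sphere U \<longleftrightarrow> (\<forall>x\<in>U. \<forall>\<^sub>F (x', y) in uniformity. x' = x \<longrightarrow> y \<in> U)"

instance
proof
  fix x y z :: riemann_sphere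
  have b: "\<bar>stereographic a \<bullet> stereographic b\<bar> \<le> 1" for a b
    using Cauchy_Schwarz_ineq2[of "stereographic a" "stereographic b"]
    by (simp add: norm_stereographic)
  have n: "stereographic a \<bullet> stereographic a = 1" for a
    by (simp add: norm_stereographic flip: power2_norm_eq_inner)
  show "dist x y = 0 \<longleftrightarrow> x = y"
  proof
    assume "dist x y = 0"
    then have "cos (arccos (stereographic x \<bullet> stereographic y)) = 1"
      by (simp add: dist_riemann_sphere_def)
    then have 1: "stereographic x \<bullet> stereographic y = 1"
      using b by (simp add: cos_arccos_abs)
    have "(stereographic x - stereographic y) \<bullet> (stereographic x - stereographic y) = 0"
      by (simp add: inner_diff_left inner_diff_right n 1 inner_commute)
    then show "x = y" by (simp add: stereographic_inject)
  qed (simp add: dist_riemann_sphere_def n)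
  have "dist x y \<le> dist x z + dist z y"
    unfolding dist_riemann_sphere_def by (intro arccos_inner_triangle norm_stereographic)
  then show "dist x y \<le> dist x z + dist y z"
    by (simp add: dist_riemann_sphere_def inner_commute)
qed (simp_all add: uniformity_riemann_sphere_def open_riemann_sphere_def)

end

text \<open>The local coordinate used around \<open>a\<close> is \<open>z\<close> if \<open>a\<close> is finite and \<open>1/z\<close> if
  \<open>a\<close> is infinity; the value at the one point off the chart is irrelevant.\<close>

definition chart :: "riemann_sphere \<Rightarrow> riemann_sphere \<Rightarrow> complex" where
  "chart a x = (case x of
       Fin z \<Rightarrow> if a = Infty then 1 / z else z
     | Infty \<Rightarrow> 0)"

definition chart_inv :: "riemann_sphere \<Rightarrow> complex \<Rightarrow> riemann_sphere" where
  "chart_inv a w = (if a = Infty then (if w = 0 then Infty else Fin (1 / w)) else Fin w)"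

text \<open>Operator norm of the derivative with respect to the spherical metric.  The density
  \<open>2 / (1 + |w|\<^sup>2)\<close> is the same in both charts because \<open>z \<mapsto> 1/z\<close> is a spherical isometry.\<close>

definition spherical_deriv_norm :: "(riemann_sphere \<Rightarrow> riemann_sphere) \<Rightarrow> riemann_sphere \<Rightarrow> real" where
  "spherical_deriv_norm \<phi> a =
     (2 / (1 + (cmod (chart (\<phi> a) (\<phi> a)))\<^sup>2))
       * cmod (deriv (\<lambda>w. chart (\<phi> a) (\<phi> (chart_inv a w))) (chart a a))
       / (2 / (1 + (cmod (chart a a))\<^sup>2))"

text \<open>If \<open>degree P < degree Q\<close> then \<open>coeff P (degree Q) = 0\<close>, as required at infinity.\<close>

fun ratio_map :: "complex poly \<Rightarrow> complex poly \<Rightarrow> riemann_sphere \<Rightarrow> riemann_sphere" where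
  "ratio_map P Q (Fin z) = (if poly Q z = 0 then Infty else Fin (poly P z / poly Q z))"
| "ratio_map P Q Infty =
     (if degree P > degree Q then Infty else Fin (coeff P (degree Q) / lead_coeff Q))"

definition rational_map :: "(riemann_sphere \<Rightarrow> riemann_sphere) \<Rightarrow> bool" where
  "rational_map \<phi> \<longleftrightarrow> (\<exists>P Q. Q \<noteq> 0 \<and> coprime P Q \<and> \<phi> = ratio_map P Q)"

section \<open>Julia sets and skew products\<close>

definition normal_family :: "('a::metric_space \<Rightarrow> 'b::metric_space) set \<Rightarrow> 'a set \<Rightarrow> bool" where
  "normal_family \<F> U \<longleftrightarrow>
     (\<forall>\<phi>::nat \<Rightarrow> 'a \<Rightarrow> 'b. range \<phi> \<subseteq> \<F> \<longrightarrow>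
        (\<exists>r g. strict_mono r \<and>
           (\<forall>K. compact K \<and> K \<subseteq> U \<longrightarrow> uniform_limit K (\<phi> \<circ> r) g sequentially)))"

definition julia_of :: "('a::metric_space \<Rightarrow> 'b::metric_space) set \<Rightarrow> 'a set" where
  "julia_of \<F> = {z. \<forall>U. open U \<and> z \<in> U \<longrightarrow> \<not> normal_family \<F> U}"

inductive_set generated_semigroup :: "('a \<Rightarrow> 'a) set \<Rightarrow> ('a \<Rightarrow> 'a) set" for S where
  generator: "g \<in> S \<Longrightarrow> g \<in> generated_semigroup S"
| compose: "g \<in> generated_semigroup S \<Longrightarrow> h \<in> generated_semigroup S \<Longrightarrow>
    g \<circ> h \<in> generated_semigroup S"

type_synonym skew_point = "(int \<Rightarrow> nat) \<times> riemann_sphere"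

definition Sigma_seq :: "nat \<Rightarrow> (int \<Rightarrow> nat) set" where
  "Sigma_seq m = {\<omega>. range \<omega> \<subseteq> {1..m}}"

definition left_shift :: "(int \<Rightarrow> nat) \<Rightarrow> (int \<Rightarrow> nat)" where
  "left_shift \<omega> = (\<lambda>i. \<omega> (i + 1))"

definition skew_product :: "(nat \<Rightarrow> riemann_sphere \<Rightarrow> riemann_sphere) \<Rightarrow> skew_point \<Rightarrow> skew_point" where
  "skew_product f x = (left_shift (fst x), f (fst x 1) (snd x))"

primrec fibre_iterate ::
  "(nat \<Rightarrow> riemann_sphere \<Rightarrow> riemann_sphere) \<Rightarrow> (int \<Rightarrow> nat) \<Rightarrow> nat \<Rightarrow> riemann_sphere \<Rightarrow> riemann_sphere"
where
  "fibre_iterate f \<omega> 0 = id"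
| "fibre_iterate f \<omega> (Suc n) = f (\<omega> (int (Suc n))) \<circ> fibre_iterate f \<omega> n"

definition fibre_julia ::
  "(nat \<Rightarrow> riemann_sphere \<Rightarrow> riemann_sphere) \<Rightarrow> (int \<Rightarrow> nat) \<Rightarrow> riemann_sphere set" where
  "fibre_julia f \<omega> = julia_of {fibre_iterate f \<omega> n | n. n \<ge> 1}"

text \<open>\<^term>\<open>Sigma_seq m\<close> is closed in the product of discrete spaces \<^typ>\<open>int \<Rightarrow> nat\<close>, so the
  closure in \<^typ>\<open>skew_point\<close> is the closure in \<open>Sigma_seq m \<times> UNIV\<close>.\<close>

definition skew_julia ::
  "nat \<Rightarrow> (nat \<Rightarrow> riemann_sphere \<Rightarrow> riemann_sphere) \<Rightarrow> skew_point set" where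
  "skew_julia m f = closure (\<Union>\<omega>\<in>Sigma_seq m. {\<omega>} \<times> fibre_julia f \<omega>)"

definition expanding :: "nat \<Rightarrow> (nat \<Rightarrow> riemann_sphere \<Rightarrow> riemann_sphere) \<Rightarrow> bool" where
  "expanding m f \<longleftrightarrow>
     julia_of (generated_semigroup (f ` {1..m})) \<noteq> {} \<and>
     (\<exists>C \<rho>. C > 0 \<and> \<rho> > 1 \<and>
        (\<forall>n\<ge>1. \<forall>(\<omega>, z)\<in>skew_julia m f.
           spherical_deriv_norm (fibre_iterate f \<omega> n) z \<ge> C * \<rho> ^ n))"

section \<open>Conditional entropy\<close>

text \<open>Sub-\<open>\<sigma>\<close>-algebras are represented, as in \<^const>\<open>real_cond_exp\<close>, by measure spaces of
  which only the carrier and the measurable sets matter.\<close>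

definition sigma_join :: "'a measure \<Rightarrow> 'a measure \<Rightarrow> 'a measure" (infixl \<open>\<squnion>\<^sub>\<sigma>\<close> 65) where
  "A \<squnion>\<^sub>\<sigma> B = sigma (space A \<union> space B) (sets A \<union> sets B)"

definition finite_measurable_partition :: "'a measure \<Rightarrow> 'a set set \<Rightarrow> bool" where
  "finite_measurable_partition M \<xi> \<longleftrightarrow> finite \<xi> \<and> partition_on (space M) \<xi> \<and> \<xi> \<subseteq> sets M"

text \<open>For finite partitions.  The convention \<open>ln 0 = 0\<close> only matters on a null set.\<close>

definition cond_information :: "'a measure \<Rightarrow> 'a set set \<Rightarrow> 'a measure \<Rightarrow> 'a \<Rightarrow> real" where
  "cond_information \<nu> \<xi> \<A> x =
     - (\<Sum>A\<in>\<xi>. indicator A x * ln (real_cond_exp \<nu> \<A> (indicator A) x))"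

definition cond_entropy :: "'a measure \<Rightarrow> 'a set set \<Rightarrow> 'a measure \<Rightarrow> real" where
  "cond_entropy \<nu> \<xi> \<A> = (\<integral>x. cond_information \<nu> \<xi> \<A> x \<partial>\<nu>)"

section \<open>Conditional projection entropy\<close>

definition Pi_adapted ::
  "nat \<Rightarrow> (nat \<Rightarrow> riemann_sphere \<Rightarrow> riemann_sphere) \<Rightarrow> skew_point set set \<Rightarrow> bool" where
  "Pi_adapted m f \<R> \<longleftrightarrow>
     finite_measurable_partition (restrict_space borel (skew_julia m f)) \<R> \<and>
     (\<forall>R\<in>\<R>. \<exists>j\<in>{1..m}. \<exists>K U. compact K \<and> open U \<and>
        R \<subseteq> skew_julia m f \<inter> ({\<omega>\<in>Sigma_seq m. \<omega> 1 = j} \<times> K) \<and> K \<subseteq> U \<and> inj_on (f j) U)"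

definition factor_algebra ::
  "nat \<Rightarrow> (nat \<Rightarrow> riemann_sphere \<Rightarrow> riemann_sphere) \<Rightarrow> (skew_point \<Rightarrow> int \<Rightarrow> nat) \<Rightarrow> skew_point measure" where
  "factor_algebra m f p =
     vimage_algebra (skew_julia m f) p (restrict_space borel (Sigma_seq m))"

definition projection_algebra ::
  "nat \<Rightarrow> (nat \<Rightarrow> riemann_sphere \<Rightarrow> riemann_sphere) \<Rightarrow> skew_point measure" where
  "projection_algebra m f = vimage_algebra (skew_julia m f) snd borel"

definition pulled_projection_algebra ::
  "nat \<Rightarrow> (nat \<Rightarrow> riemann_sphere \<Rightarrow> riemann_sphere) \<Rightarrow> skew_point measure" where
  "pulled_projection_algebra m f =
     vimage_algebra (skew_julia m f) (skew_product f) (projection_algebra m f)"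

definition invariant_algebra ::
  "nat \<Rightarrow> (nat \<Rightarrow> riemann_sphere \<Rightarrow> riemann_sphere) \<Rightarrow> skew_point measure" where
  "invariant_algebra m f =
     sigma (skew_julia m f)
       {B \<in> sets (restrict_space borel (skew_julia m f)).
          skew_product f -` B \<inter> skew_julia m f = B}"

definition projection_entropy ::
  "nat \<Rightarrow> (nat \<Rightarrow> riemann_sphere \<Rightarrow> riemann_sphere) \<Rightarrow> (skew_point \<Rightarrow> int \<Rightarrow> nat) \<Rightarrow>
     skew_point measure \<Rightarrow> skew_point set set \<Rightarrow> real" where
  "projection_entropy m f p \<mu> \<R> =
     cond_entropy \<mu> \<R> (factor_algebra m f p \<squnion>\<^sub>\<sigma> pulled_projection_algebra m f)
     - cond_entropy \<mu> \<R> (factor_algebra m f p \<squnion>\<^sub>\<sigma> projection_algebra m f)"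

definition local_projection_entropy ::
  "nat \<Rightarrow> (nat \<Rightarrow> riemann_sphere \<Rightarrow> riemann_sphere) \<Rightarrow> (skew_point \<Rightarrow> int \<Rightarrow> nat) \<Rightarrow>
     skew_point measure \<Rightarrow> skew_point \<Rightarrow> skew_point set set \<Rightarrow> real" where
  "local_projection_entropy m f p \<mu> x \<R> =
     real_cond_exp \<mu> (invariant_algebra m f)
       (\<lambda>y. cond_information \<mu> \<R> (factor_algebra m f p \<squnion>\<^sub>\<sigma> pulled_projection_algebra m f) y
          - cond_information \<mu> \<R> (factor_algebra m f p \<squnion>\<^sub>\<sigma> projection_algebra m f) y) x"

end

theory Submission
  imports Defs
begin

text \<open>The information functions of \<open>\<R>1\<close> and \<open>\<R>2\<close> are compared through the common refinement
  \<open>\<R>1 \<or> \<R>2\<close>. Write \<open>P\<close> for the factor algebra \<open>p\<^sup>-\<^sup>1\<B>(\<Sigma>)\<close>, and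
  \<open>\<Q> = \<Pi>\<^sup>-\<^sup>1\<gamma>\<close>, \<open>\<Q>' = f\<^sup>-\<^sup>1\<Pi>\<^sup>-\<^sup>1\<gamma>\<close> for the two projection algebras. For every sub-algebra \<open>F\<close> the chain rule
  (lemma \<open>cond_information_chain_rule\<close>) gives, almost everywhere,
  \<open>I(\<R>1 \<or> \<R>2 | F) = I(\<R>1 | F) + I(\<R>2 | F \<or> \<R>1)\<close>.

  What makes an adapted partition \<open>\<R>\<close> special is that \<open>P \<or> \<Q>' \<or> \<R> = P \<or> \<Q> \<or> \<R>\<close>, exactly and not
  merely modulo null sets (lemma \<open>Pi_adapted_join_eq\<close>). On an atom \<open>R \<subseteq> [j] \<times> K\<close> the skew product acts on the
  second coordinate by \<open>f j\<close>, which is continuous and injective on the compact set \<open>K\<close> and hence a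
  homeomorphism of \<open>K\<close> onto its image; so on \<open>R\<close> the second coordinates of a point and of its image
  determine each other in a Borel way. Therefore, when the chain rules for \<open>F = P \<or> \<Q>'\<close> and
  \<open>F = P \<or> \<Q>\<close> are subtracted, the terms conditioned on \<open>\<R>1\<close> cancel, and
  \<open>I(\<R>1 | P \<or> \<Q>') - I(\<R>1 | P \<or> \<Q>) = I(\<R>1 \<or> \<R>2 | P \<or> \<Q>') - I(\<R>1 \<or> \<R>2 | P \<or> \<Q>)\<close>
  almost everywhere. The right-hand side is symmetric in \<open>\<R>1\<close> and \<open>\<R>2\<close>, so the integrands defining the
  two local entropies already agree almost everywhere (lemma \<open>cond_information_diff_eq\<close>). Conditioning on
  the invariant algebra gives the local statement. Integrating gives the global one, because each
  information function is integrable (lemma \<open>integrable_cond_information\<close>).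

  Two facts about the dynamics are needed to apply this: rational maps are continuous for the spherical
  metric (lemma \<open>rational_map_continuous\<close>), and the skew product maps its Julia set into itself (lemma
  \<open>skew_julia_forward\<close>), which makes the pulled back projection algebra consist of the full preimages.\<close>

section \<open>Joins of sigma-algebras\<close>

lemma sets_sigma_join:
  assumes "space A = \<Omega>" "space B = \<Omega>"
  shows "space (A \<squnion>\<^sub>\<sigma> B) = \<Omega>" "sets (A \<squnion>\<^sub>\<sigma> B) = sigma_sets \<Omega> (sets A \<union> sets B)"
proof -
  have "sets A \<union> sets B \<subseteq> Pow \<Omega>"
    using sets.sets_into_space[of _ A] sets.sets_into_space[of _ B] assms by auto
  then show "space (A \<squnion>\<^sub>\<sigma> B) = \<Omega>" "sets (A \<squnion>\<^sub>\<sigma> B) = sigma_sets \<Omega> (sets A \<union> sets B)"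
    by (simp_all add: sigma_join_def assms)
qed

lemma sigma_join_least:
  assumes "space A = space M" "space B = space M" "sets A \<subseteq> sets M" "sets B \<subseteq> sets M"
  shows "sets (A \<squnion>\<^sub>\<sigma> B) \<subseteq> sets M"
  unfolding sets_sigma_join(2)[OF assms(1,2)]
  by (rule sets.sigma_sets_subset) (use assms in auto)

lemma subalgebra_sigma_join:
  assumes "subalgebra M A" "subalgebra M B"
  shows "subalgebra M (A \<squnion>\<^sub>\<sigma> B)"
  using assms sigma_join_least[of A M B] by (simp add: subalgebra_def sets_sigma_join)

lemma subalgebra_sigma_join_left:
  assumes "space A = space B"
  shows "subalgebra (A \<squnion>\<^sub>\<sigma> B) A"
  using assms by (auto simp: subalgebra_def sets_sigma_join)

lemma subalgebra_sigma_join_right: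
  assumes "space A = space B"
  shows "subalgebra (A \<squnion>\<^sub>\<sigma> B) B"
  using assms by (auto simp: subalgebra_def sets_sigma_join)

text \<open>A join carries the zero measure, so two joins with the same measurable sets are equal as measure
  objects and can be substituted for each other in any conditional expectation.\<close>
lemma sigma_join_cong:
  assumes "space A = space B" "space A' = space B'" "space A = space A'"
    and "sets (A \<squnion>\<^sub>\<sigma> B) = sets (A' \<squnion>\<^sub>\<sigma> B')"
  shows "A \<squnion>\<^sub>\<sigma> B = A' \<squnion>\<^sub>\<sigma> B'"
  by (rule measure_eqI[OF assms(4)]) (simp add: sigma_join_def emeasure_sigma)

lemma finite_measurable_partitionD:
  assumes "finite_measurable_partition M \<xi>"
  shows "finite \<xi>" "\<Union>\<xi> = space M" "disjoint \<xi>" "{} \<notin> \<xi>" "\<And>A. A \<in> \<xi> \<Longrightarrow> A \<in> sets M"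
  using assms by (auto simp: finite_measurable_partition_def partition_on_def)

lemma subalgebra_sigma_partition:
  assumes "finite_measurable_partition M \<xi>"
  shows "subalgebra M (sigma (space M) \<xi>)" "\<And>A. A \<in> \<xi> \<Longrightarrow> A \<in> sets (sigma (space M) \<xi>)"
proof -
  have *: "\<xi> \<subseteq> sets M" "\<xi> \<subseteq> Pow (space M)"
    using finite_measurable_partitionD[OF assms] sets.sets_into_space by blast+
  show "subalgebra M (sigma (space M) \<xi>)" "\<And>A. A \<in> \<xi> \<Longrightarrow> A \<in> sets (sigma (space M) \<xi>)"
    using * by (auto simp: subalgebra_def intro: sets.sigma_sets_subset[THEN subsetD])
qed

text \<open>A set in \<open>Q\<close> is the finite union of its traces on the atoms. If each trace is also the trace of a set
  in \<open>Q'\<close>, then the atoms and \<open>Q'\<close> together generate it. So once the partition is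
  joined, only the traces on the atoms matter.\<close>
lemma sigma_join_partition_mono:
  assumes sp: "space P = \<Omega>" "space Q = \<Omega>" "space Q' = \<Omega>"
    and \<xi>: "finite \<xi>" "\<Union>\<xi> = \<Omega>"
    and loc: "\<And>A D. A \<in> \<xi> \<Longrightarrow> D \<in> sets Q \<Longrightarrow> \<exists>E\<in>sets Q'. D \<inter> A = E \<inter> A"
  shows "sets (P \<squnion>\<^sub>\<sigma> Q \<squnion>\<^sub>\<sigma> sigma \<Omega> \<xi>) \<subseteq> sets (P \<squnion>\<^sub>\<sigma> Q' \<squnion>\<^sub>\<sigma> sigma \<Omega> \<xi>)"
proof -
  let ?N = "P \<squnion>\<^sub>\<sigma> Q' \<squnion>\<^sub>\<sigma> sigma \<Omega> \<xi>"
  have \<xi>': "\<xi> \<subseteq> Pow \<Omega>" using \<xi>(2) by auto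
  have sp\<xi>: "space (sigma \<Omega> \<xi>) = \<Omega>" using \<xi>' by simp
  have spJ: "space (P \<squnion>\<^sub>\<sigma> Q) = \<Omega>" "space (P \<squnion>\<^sub>\<sigma> Q') = \<Omega>"
    by (intro sets_sigma_join(1) sp)+
  have spN: "space ?N = \<Omega>" by (intro sets_sigma_join(1) spJ sp\<xi>)
  have 1: "sets (P \<squnion>\<^sub>\<sigma> Q') \<subseteq> sets ?N" "sets (sigma \<Omega> \<xi>) \<subseteq> sets ?N"
    using subalgebra_sigma_join_left[of "P \<squnion>\<^sub>\<sigma> Q'" "sigma \<Omega> \<xi>"]
      subalgebra_sigma_join_right[of "P \<squnion>\<^sub>\<sigma> Q'" "sigma \<Omega> \<xi>"]
    unfolding subalgebra_def spJ sp\<xi> by simp_all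
  have 2: "sets P \<subseteq> sets (P \<squnion>\<^sub>\<sigma> Q')" "sets Q' \<subseteq> sets (P \<squnion>\<^sub>\<sigma> Q')"
    using subalgebra_sigma_join_left[of P Q'] subalgebra_sigma_join_right[of P Q']
    unfolding subalgebra_def sp by simp_all
  have atom: "A \<in> sets ?N" if "A \<in> \<xi>" for A
    using 1(2) \<xi>' that by auto
  have "sets Q \<subseteq> sets ?N"
  proof
    fix D assume D: "D \<in> sets Q"
    then have "\<forall>A\<in>\<xi>. \<exists>E\<in>sets Q'. D \<inter> A = E \<inter> A" using loc by blast
    then obtain E where E: "\<And>A. A \<in> \<xi> \<Longrightarrow> E A \<in> sets Q'" "\<And>A. A \<in> \<xi> \<Longrightarrow> D \<inter> A = E A \<inter> A"
      by metis
    have "D \<subseteq> \<Omega>" using sets.sets_into_space[OF D] sp by simp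
    then have "D = (\<Union>A\<in>\<xi>. D \<inter> A)" using \<xi>(2) by auto
    also have "\<dots> = (\<Union>A\<in>\<xi>. E A \<inter> A)" using E(2) by auto
    also have "\<dots> \<in> sets ?N"
      using \<xi>(1) E(1) 1(1) 2(2) by (intro sets.finite_UN sets.Int) (auto intro: atom)
    finally show "D \<in> sets ?N" .
  qed
  then have "sets (P \<squnion>\<^sub>\<sigma> Q) \<subseteq> sets ?N"
    using 1(1) 2(1) by (intro sigma_join_least[where A = P and B = Q]) (auto simp only: sp spN)
  then show ?thesis
    using 1(2) by (intro sigma_join_least[where B = "sigma \<Omega> \<xi>"]) (simp_all only: spJ spN sp\<xi>)
qed

lemma sigma_join_partition_cong:
  assumes sp: "space P = \<Omega>" "space Q = \<Omega>" "space Q' = \<Omega>"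
    and \<xi>: "finite \<xi>" "\<Union>\<xi> = \<Omega>"
    and loc: "\<And>A D. A \<in> \<xi> \<Longrightarrow> D \<in> sets Q \<Longrightarrow> \<exists>E\<in>sets Q'. D \<inter> A = E \<inter> A"
    and loc': "\<And>A E. A \<in> \<xi> \<Longrightarrow> E \<in> sets Q' \<Longrightarrow> \<exists>D\<in>sets Q. E \<inter> A = D \<inter> A"
  shows "P \<squnion>\<^sub>\<sigma> Q \<squnion>\<^sub>\<sigma> sigma \<Omega> \<xi> = P \<squnion>\<^sub>\<sigma> Q' \<squnion>\<^sub>\<sigma> sigma \<Omega> \<xi>"
proof (rule sigma_join_cong)
  have "\<xi> \<subseteq> Pow \<Omega>" using \<xi>(2) by auto
  then have "space (sigma \<Omega> \<xi>) = \<Omega>" by simp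
  moreover have "space (P \<squnion>\<^sub>\<sigma> Q) = \<Omega>" "space (P \<squnion>\<^sub>\<sigma> Q') = \<Omega>"
    by (intro sets_sigma_join(1) sp)+
  ultimately show "space (P \<squnion>\<^sub>\<sigma> Q) = space (sigma \<Omega> \<xi>)" "space (P \<squnion>\<^sub>\<sigma> Q') = space (sigma \<Omega> \<xi>)"
    "space (P \<squnion>\<^sub>\<sigma> Q) = space (P \<squnion>\<^sub>\<sigma> Q')"
    by simp_all
  show "sets (P \<squnion>\<^sub>\<sigma> Q \<squnion>\<^sub>\<sigma> sigma \<Omega> \<xi>) = sets (P \<squnion>\<^sub>\<sigma> Q' \<squnion>\<^sub>\<sigma> sigma \<Omega> \<xi>)"
    using sigma_join_partition_mono[OF sp(1) sp(2) sp(3) \<xi> loc]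
      sigma_join_partition_mono[OF sp(1) sp(3) sp(2) \<xi> loc'] by (rule subset_antisym)
qed

lemma subalgebra_vimage_algebra:
  assumes "g \<in> M \<rightarrow>\<^sub>M N"
  shows "subalgebra M (vimage_algebra (space M) g N)"
proof -
  have "{g -` A \<inter> space M | A. A \<in> sets N} \<subseteq> sets M"
    using measurable_sets[OF assms] by auto
  then have "sets (vimage_algebra (space M) g N) \<subseteq> sets M"
    unfolding sets_vimage_algebra by (rule sets.sigma_sets_subset)
  then show ?thesis by (simp add: subalgebra_def)
qed

text \<open>Adjoining a partition does not refine \<open>F\<close> inside a single atom: the sets whose trace on \<open>A\<close> is the
  trace of a set in \<open>F\<close> form a sigma-algebra containing \<open>F\<close> and, by disjointness, every atom.\<close>
lemma trace_sigma_join_partition: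
  assumes F: "space F = \<Omega>" and \<xi>: "\<xi> \<subseteq> Pow \<Omega>" "disjoint \<xi>" and "A \<in> \<xi>"
    and "C \<in> sets (F \<squnion>\<^sub>\<sigma> sigma \<Omega> \<xi>)"
  shows "\<exists>D\<in>sets F. C \<inter> A = D \<inter> A"
proof -
  have gen: "sets (F \<squnion>\<^sub>\<sigma> sigma \<Omega> \<xi>) = sigma_sets \<Omega> (sets F \<union> sigma_sets \<Omega> \<xi>)"
    using F \<xi> by (simp add: sets_sigma_join)
  have step: "\<exists>D\<in>sets F. C \<inter> A = D \<inter> A"
    if C: "C \<in> sigma_sets \<Omega> S" and base: "\<And>C. C \<in> S \<Longrightarrow> \<exists>D\<in>sets F. C \<inter> A = D \<inter> A" for C S
    using C
  proof induction
    case (Compl C)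
    then obtain D where D: "D \<in> sets F" "C \<inter> A = D \<inter> A" by auto
    have "A \<subseteq> \<Omega>" using \<xi> \<open>A \<in> \<xi>\<close> by auto
    then have "(\<Omega> - C) \<inter> A = (\<Omega> - D) \<inter> A" using D by auto
    then show ?case using D F by (metis sets.compl_sets)
  next
    case (Union C)
    then obtain D where D: "\<And>i::nat. D i \<in> sets F" "\<And>i. C i \<inter> A = D i \<inter> A" by metis
    then have "(\<Union>i. C i) \<inter> A = (\<Union>i. D i) \<inter> A" by auto
    then show ?case using D(1) by (intro bexI[of _ "\<Union>i. D i"]) auto
  qed (use base in \<open>auto\<close>)
  have "\<exists>D\<in>sets F. B \<inter> A = D \<inter> A" if "B \<in> \<xi>" for B
  proof (cases "B = A")
    case True
    then show ?thesis using \<xi>(1) \<open>A \<in> \<xi>\<close> F by (intro bexI[of _ \<Omega>]) auto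
  next
    case False
    then have "B \<inter> A = {}" using \<xi>(2) that \<open>A \<in> \<xi>\<close> by (auto simp: disjoint_def)
    then show ?thesis by (intro bexI[of _ "{}"]) auto
  qed
  note atoms = step[OF _ this]
  show ?thesis
  proof (rule step[OF assms(5)[unfolded gen]])
    fix C assume "C \<in> sets F \<union> sigma_sets \<Omega> \<xi>"
    then show "\<exists>D\<in>sets F. C \<inter> A = D \<inter> A"
      using atoms[of C] by blast
  qed
qed

text \<open>The version of the previous lemma for functions, by induction over the construction of
  \<open>g\<close>. Here \<open>A\<close> need not belong to \<open>F\<close>, so \<open>g\<close> cannot simply be cut off outside \<open>A\<close>.\<close>
lemma borel_measurable_trace_lift:
  fixes g :: "'a \<Rightarrow> ennreal"
  assumes "g \<in> borel_measurable G" and sp: "space F = space G"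
    and tr: "\<And>C. C \<in> sets G \<Longrightarrow> \<exists>D\<in>sets F. C \<inter> A = D \<inter> A"
  shows "\<exists>u\<in>borel_measurable F. \<forall>x\<in>A \<inter> space G. u x = g x"
  using assms(1)
proof (induction rule: borel_measurable_induct)
  case (cong f g)
  then show ?case by simp
next
  case (set C)
  then obtain D where "D \<in> sets F" "C \<inter> A = D \<inter> A" using tr by blast
  then show ?case by (intro bexI[of _ "indicator D"]) (auto simp: indicator_def)
next
  case (mult g c)
  then obtain u where "u \<in> borel_measurable F" "\<forall>x\<in>A \<inter> space G. u x = g x" by blast
  then show ?case by (intro bexI[of _ "\<lambda>x. c * u x"]) auto
next
  case (add g h)
  then obtain u v where "u \<in> borel_measurable F" "\<forall>x\<in>A \<inter> space G. u x = g x"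
    "v \<in> borel_measurable F" "\<forall>x\<in>A \<inter> space G. v x = h x" by blast
  then show ?case by (intro bexI[of _ "\<lambda>x. v x + u x"]) auto
next
  case (seq U)
  then obtain u where u: "\<And>i. u i \<in> borel_measurable F" "\<And>i. \<forall>x\<in>A \<inter> space G. u i x = U i x" by metis
  then show ?case by (intro bexI[of _ "\<lambda>x. SUP i. u i x"]) (auto simp: image_image)
qed

section \<open>Conditional probabilities given a partition\<close>

lemma (in finite_measure) finite_measure_sigma_finite_subalgebra:
  assumes "subalgebra M F"
  shows "sigma_finite_subalgebra M F"
proof -
  interpret finite_measure_subalgebra M F by standard (fact assms)
  show ?thesis by unfold_locales
qed

text \<open>For the strict positivity on \<open>A\<close>: the set \<open>N\<close> where the conditional probability is at most \<open>0\<close> lies in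
  \<open>F\<close>, so integrating over \<open>N\<close> gives measure \<open>0\<close> for \<open>N \<inter> A\<close>. It makes the logarithms in the information
  function genuine almost everywhere.\<close>
lemma (in finite_measure) cond_exp_indicator:
  assumes F: "subalgebra M F" and A[measurable]: "A \<in> sets M"
  shows "AE x in M. 0 \<le> real_cond_exp M F (indicator A) x"
    "AE x in M. real_cond_exp M F (indicator A) x \<le> 1"
    "AE x in M. x \<in> A \<longrightarrow> 0 < real_cond_exp M F (indicator A) x"
proof -
  interpret sigma_finite_subalgebra M F by (rule finite_measure_sigma_finite_subalgebra[OF F])
  have int: "integrable M (indicator A :: 'a \<Rightarrow> real)"
    by (simp add: emeasure_eq_measure)
  show "AE x in M. 0 \<le> real_cond_exp M F (indicator A) x"
    by (rule real_cond_exp_ge_c[OF int]) simp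
  show "AE x in M. real_cond_exp M F (indicator A) x \<le> 1"
    by (rule real_cond_exp_le_c[OF int]) (simp add: indicator_def)
  let ?g = "real_cond_exp M F (indicator A) :: 'a \<Rightarrow> real"
  define N where "N = {x \<in> space F. ?g x \<le> 0}"
  have N: "N \<in> sets F" unfolding N_def by measurable
  then have N'[measurable]: "N \<in> sets M" using F by (auto simp: subalgebra_def)
  have "(\<integral>x\<in>N. indicator A x \<partial>M) = (\<integral>x\<in>N. ?g x \<partial>M)"
    by (rule real_cond_exp_intA[OF int N])
  also have "\<dots> \<le> 0"
  proof -
    have "0 \<le> (\<integral>x. - (indicator N x *\<^sub>R ?g x) \<partial>M)"
      by (rule integral_nonneg_AE) (auto simp: N_def indicator_def)
    then show ?thesis by (simp add: set_lebesgue_integral_def)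
  qed
  also have "(\<integral>x\<in>N. indicator A x \<partial>M) = measure M (N \<inter> A)"
    by (simp add: set_lebesgue_integral_def flip: indicator_inter_arith)
  finally have "measure M (N \<inter> A) = 0" by (simp add: measure_le_0_iff)
  then have "N \<inter> A \<in> null_sets M" by (simp add: emeasure_eq_measure null_setsI)
  then show "AE x in M. x \<in> A \<longrightarrow> 0 < ?g x"
    by (rule AE_I') (use F sets.sets_into_space[OF A] in \<open>auto simp: N_def subalgebra_def not_less\<close>)
qed

text \<open>This is the formula \<open>P(A \<inter> B | F) = P(B | F \<or> \<xi>) P(A | F)\<close> on an atom \<open>A\<close>. On \<open>A\<close> the function
  \<open>g = P(B | F \<or> \<xi>)\<close> coincides with an \<open>F\<close>-measurable function \<open>v\<close>. By the tower property
  \<open>P(A \<inter> B | F) = E(1\<^sub>A g | F) = E(1\<^sub>A v | F) = v P(A | F)\<close>, and \<open>v\<close> is \<open>g\<close> again on \<open>A\<close>.\<close>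
lemma (in finite_measure) cond_exp_sigma_join_partition:
  assumes F: "subalgebra M F" and \<xi>: "finite_measurable_partition M \<xi>"
    and A: "A \<in> \<xi>" and B[measurable]: "B \<in> sets M"
  shows "AE x in M. x \<in> A \<longrightarrow>
    real_cond_exp M F (indicator (A \<inter> B)) x =
    real_cond_exp M (F \<squnion>\<^sub>\<sigma> sigma (space M) \<xi>) (indicator B) x * real_cond_exp M F (indicator A) x"
proof -
  define G where "G = F \<squnion>\<^sub>\<sigma> sigma (space M) \<xi>"
  note P = finite_measurable_partitionD[OF \<xi>]
  have sub: "\<xi> \<subseteq> Pow (space M)" using P(5) sets.sets_into_space by blast
  have spF: "space F = space M" using F by (simp add: subalgebra_def)
  have G: "subalgebra M G" unfolding G_def
    by (intro subalgebra_sigma_join F subalgebra_sigma_partition \<xi>)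
  then have spG: "space G = space M" by (simp add: subalgebra_def)
  have FG: "subalgebra G F" and "subalgebra G (sigma (space M) \<xi>)" unfolding G_def
    using sub by (intro subalgebra_sigma_join_left subalgebra_sigma_join_right; simp add: spF)+
  then have AG[measurable]: "A \<in> sets G"
    using subalgebra_sigma_partition(2)[OF \<xi> A] by (auto simp: subalgebra_def)
  have [measurable]: "A \<in> sets M" using P(5) A by simp
  interpret F: sigma_finite_subalgebra M F by (rule finite_measure_sigma_finite_subalgebra[OF F])
  interpret G: sigma_finite_subalgebra M G by (rule finite_measure_sigma_finite_subalgebra[OF G])
  define g where "g = (real_cond_exp M G (indicator B) :: 'a \<Rightarrow> real)"
  have [measurable]: "g \<in> borel_measurable G" "g \<in> borel_measurable M" by (auto simp: g_def)
  \<comment> \<open>The lift \<open>u\<close> may be unbounded outside \<open>A\<close>; integrability is needed only for its product with \<open>1\<^sub>A\<close>.\<close>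
  have "\<exists>u\<in>borel_measurable F. \<forall>x\<in>A \<inter> space G. u x = ennreal (g x)"
  proof (rule borel_measurable_trace_lift)
    fix C assume "C \<in> sets G"
    then show "\<exists>D\<in>sets F. C \<inter> A = D \<inter> A"
      using trace_sigma_join_partition[of F "space M" \<xi> A C] spF sub P(3) A by (auto simp: G_def)
  qed (auto simp: spF spG)
  then obtain u where [measurable]: "u \<in> borel_measurable F"
    and u: "\<And>x. x \<in> A \<Longrightarrow> u x = ennreal (g x)"
    using sub A spG by fast
  define v where "v x = enn2real (u x)" for x
  have vF[measurable]: "v \<in> borel_measurable F" unfolding v_def by measurable
  have vM[measurable]: "v \<in> borel_measurable M" by (rule measurable_from_subalg[OF F vF])
  have g0: "AE x in M. 0 \<le> g x" unfolding g_def by (rule cond_exp_indicator(1)[OF G B])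
  then have ae: "AE x in M. indicator A x * g x = v x * indicator A x"
    by eventually_elim (auto simp: indicator_def v_def u)
  have "integrable M (\<lambda>x. indicator A x * g x)"
    using integrable_mult_indicator[of A M g] G.real_cond_exp_int(1)[of "indicator B"]
    by (simp add: g_def emeasure_eq_measure)
  then have int: "integrable M (\<lambda>x. v x * indicator A x)"
    using ae by (subst integrable_cong_AE[symmetric, OF _ _ ae]) auto
  have AB: "(\<lambda>x. indicator A x * indicator B x :: real) = indicator (A \<inter> B)"
    by (auto simp: indicator_def fun_eq_iff)
  have int_AB: "integrable M (indicator (A \<inter> B) :: 'a \<Rightarrow> real)"
    by (rule integrable_real_indicator) (auto simp: emeasure_eq_measure)
  have e1: "AE x in M. real_cond_exp M F (real_cond_exp M G (indicator (A \<inter> B))) x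
      = real_cond_exp M F (indicator (A \<inter> B)) x"
    by (rule F.real_cond_exp_nested_subalg[OF G FG int_AB])
  have e2: "AE x in M. real_cond_exp M G (indicator (A \<inter> B)) x = indicator A x * g x"
    unfolding AB[symmetric] g_def
    by (rule G.real_cond_exp_mult) (simp_all add: AB int_AB)
  have e3: "AE x in M. real_cond_exp M G (indicator (A \<inter> B)) x = v x * indicator A x"
    using e2 ae by eventually_elim simp
  have e4: "AE x in M. real_cond_exp M F (real_cond_exp M G (indicator (A \<inter> B))) x
      = real_cond_exp M F (\<lambda>x. v x * indicator A x) x"
    by (rule F.real_cond_exp_cong[OF e3]) auto
  have e5: "AE x in M. real_cond_exp M F (\<lambda>x. v x * indicator A x) x
      = v x * real_cond_exp M F (indicator A) x"
    by (rule F.real_cond_exp_mult[OF vF _ int]) auto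
  show ?thesis
    using e1 e4 e5 g0 unfolding G_def[symmetric] g_def[symmetric]
  proof eventually_elim
    case (elim x)
    have "v x = g x" if "x \<in> A" using elim(4) that by (simp add: v_def u)
    then show ?case using elim(1,2,3) by auto
  qed
qed

section \<open>Information functions\<close>

lemma cond_information_on_atom:
  assumes "finite_measurable_partition M \<xi>" "A \<in> \<xi>" "x \<in> A"
  shows "cond_information \<nu> \<xi> F x = - ln (real_cond_exp \<nu> F (indicator A) x)"
proof -
  note P = finite_measurable_partitionD[OF assms(1)]
  have "x \<notin> B" if "B \<in> \<xi> - {A}" for B
    using P(3) that assms(2,3) by (auto simp: disjoint_def)
  then have "(\<Sum>B\<in>\<xi>. indicator B x * ln (real_cond_exp \<nu> F (indicator B) x))
      = (\<Sum>B\<in>{A}. indicator B x * ln (real_cond_exp \<nu> F (indicator B) x))"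
    using assms(2) P(1) by (intro sum.mono_neutral_right) auto
  then show ?thesis using assms(3) by (simp add: cond_information_def)
qed

lemma borel_measurable_cond_information:
  assumes "subalgebra M F" and "finite_measurable_partition M \<xi>"
  shows "cond_information M \<xi> F \<in> borel_measurable M"
  unfolding cond_information_def [abs_def]
  using finite_measurable_partitionD(5)[OF assms(2)] by measurable

text \<open>The empty set is removed because the parts of a partition have to be nonempty.\<close>
definition refinement :: "'a set set \<Rightarrow> 'a set set \<Rightarrow> 'a set set" where
  "refinement \<xi> \<eta> = {A \<inter> B | A B. A \<in> \<xi> \<and> B \<in> \<eta>} - {{}}"

lemma refinement_commute: "refinement \<xi> \<eta> = refinement \<eta> \<xi>"
  unfolding refinement_def
  by (rule arg_cong[where f = "\<lambda>S. S - {{}}"], rule set_eqI, unfold mem_Collect_eq) (metis Int_commute)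

lemma finite_measurable_partition_refinement:
  assumes "finite_measurable_partition M \<xi>" "finite_measurable_partition M \<eta>"
  shows "finite_measurable_partition M (refinement \<xi> \<eta>)"
proof -
  note P = finite_measurable_partitionD[OF assms(1)] and Q = finite_measurable_partitionD[OF assms(2)]
  have atomE: "\<exists>A\<in>\<xi>. \<exists>B\<in>\<eta>. C = A \<inter> B \<and> C \<noteq> {}" if "C \<in> refinement \<xi> \<eta>" for C
    using that unfolding refinement_def by blast
  have "refinement \<xi> \<eta> \<subseteq> (\<lambda>(A, B). A \<inter> B) ` (\<xi> \<times> \<eta>)"
    using atomE by fast
  then have "finite (refinement \<xi> \<eta>)"
    by (rule finite_subset) (simp add: P(1) Q(1))
  moreover have "\<Union> (refinement \<xi> \<eta>) = space M"
  proof
    show "space M \<subseteq> \<Union> (refinement \<xi> \<eta>)"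
    proof
      fix x assume "x \<in> space M"
      then obtain A B where "A \<in> \<xi>" "B \<in> \<eta>" "x \<in> A \<inter> B" using P(2) Q(2) by blast
      then show "x \<in> \<Union> (refinement \<xi> \<eta>)" unfolding refinement_def by blast
    qed
    show "\<Union> (refinement \<xi> \<eta>) \<subseteq> space M" using atomE P(2) by blast
  qed
  moreover have "disjoint (refinement \<xi> \<eta>)"
    using P(3) Q(3) unfolding disjoint_def refinement_def by blast
  moreover have "refinement \<xi> \<eta> \<subseteq> sets M"
    using atomE P(5) Q(5) by blast
  moreover have "{} \<notin> refinement \<xi> \<eta>"
    by (simp add: refinement_def)
  ultimately show ?thesis
    by (simp add: finite_measurable_partition_def partition_on_def)
qed

text \<open>On \<open>A \<inter> B\<close> this is the logarithm of the product formula for \<open>P(A \<inter> B | F)\<close>. Both factors are positive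
  almost everywhere there, so the logarithm splits.\<close>
lemma (in finite_measure) cond_information_chain_rule:
  assumes F: "subalgebra M F"
    and \<xi>: "finite_measurable_partition M \<xi>" and \<eta>: "finite_measurable_partition M \<eta>"
  shows "AE x in M. cond_information M (refinement \<xi> \<eta>) F x =
    cond_information M \<xi> F x + cond_information M \<eta> (F \<squnion>\<^sub>\<sigma> sigma (space M) \<xi>) x"
proof -
  note P = finite_measurable_partitionD[OF \<xi>] and Q = finite_measurable_partitionD[OF \<eta>]
  let ?G = "F \<squnion>\<^sub>\<sigma> sigma (space M) \<xi>"
  have "AE x in M. x \<in> A \<inter> B \<longrightarrow> cond_information M (refinement \<xi> \<eta>) F x =
      cond_information M \<xi> F x + cond_information M \<eta> ?G x"
    if AB: "A \<in> \<xi>" "B \<in> \<eta>" for A B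
  proof -
    have "A \<in> sets M" "B \<in> sets M" "A \<inter> B \<in> sets M" using P(5) Q(5) AB by auto
    show ?thesis
      using cond_exp_sigma_join_partition[OF F \<xi> AB(1) \<open>B \<in> sets M\<close>]
        cond_exp_indicator(3)[OF F \<open>A \<in> sets M\<close>] cond_exp_indicator(3)[OF F \<open>A \<inter> B \<in> sets M\<close>]
    proof eventually_elim
      case (elim x)
      show ?case
      proof
        assume x: "x \<in> A \<inter> B"
        let ?a = "real_cond_exp M F (indicator A) x" and ?b = "real_cond_exp M ?G (indicator B) x"
        have a: "0 < ?a" and ab: "0 < ?b * ?a" using elim x by auto
        then have b: "0 < ?b" by (simp add: zero_less_mult_iff)
        have "A \<inter> B \<in> refinement \<xi> \<eta>" using AB x by (auto simp: refinement_def)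
        then have "cond_information M (refinement \<xi> \<eta>) F x = - ln (?b * ?a)"
          using elim x
          by (subst cond_information_on_atom[OF finite_measurable_partition_refinement[OF \<xi> \<eta>]]) auto
        moreover have "cond_information M \<xi> F x = - ln ?a"
          using AB x by (intro cond_information_on_atom[OF \<xi>]) auto
        moreover have "cond_information M \<eta> ?G x = - ln ?b"
          using AB x by (intro cond_information_on_atom[OF \<eta>]) auto
        ultimately show "cond_information M (refinement \<xi> \<eta>) F x =
            cond_information M \<xi> F x + cond_information M \<eta> ?G x"
          using a b by (simp add: ln_mult)
      qed
    qed
  qed
  then have "AE x in M. \<forall>A\<in>\<xi>. \<forall>B\<in>\<eta>. x \<in> A \<inter> B \<longrightarrow> cond_information M (refinement \<xi> \<eta>) F x =
      cond_information M \<xi> F x + cond_information M \<eta> ?G x"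
    using P(1) Q(1) by (intro AE_finite_allI) auto
  then show ?thesis
    using AE_space
  proof eventually_elim
    case (elim x)
    then obtain A B where "A \<in> \<xi>" "B \<in> \<eta>" "x \<in> A" "x \<in> B" using P(2) Q(2) by blast
    with elim(1) show ?case by blast
  qed
qed

text \<open>Expanding the information of the common refinement in both orders, for \<open>F\<close> and for \<open>F'\<close>, gives four
  equations. By the two hypotheses on joins the terms conditioned on a partition cancel in pairs.\<close>
lemma (in finite_measure) cond_information_diff_eq:
  assumes F: "subalgebra M F" "subalgebra M F'"
    and \<xi>: "finite_measurable_partition M \<xi>" "F \<squnion>\<^sub>\<sigma> sigma (space M) \<xi> = F' \<squnion>\<^sub>\<sigma> sigma (space M) \<xi>"
    and \<eta>: "finite_measurable_partition M \<eta>" "F \<squnion>\<^sub>\<sigma> sigma (space M) \<eta> = F' \<squnion>\<^sub>\<sigma> sigma (space M) \<eta>"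
  shows "AE x in M. cond_information M \<xi> F x - cond_information M \<xi> F' x =
    cond_information M \<eta> F x - cond_information M \<eta> F' x"
  using cond_information_chain_rule[OF F(1) \<xi>(1) \<eta>(1)] cond_information_chain_rule[OF F(2) \<xi>(1) \<eta>(1)]
    cond_information_chain_rule[OF F(1) \<eta>(1) \<xi>(1)] cond_information_chain_rule[OF F(2) \<eta>(1) \<xi>(1)]
  unfolding refinement_commute[of \<eta> \<xi>] \<xi>(2) \<eta>(2)
  by eventually_elim simp

text \<open>With \<open>g = P(A | F)\<close>, replacing \<open>1\<^sub>A\<close> by its conditional expectation turns the integral of
  \<open>1\<^sub>A |ln g|\<close> into the integral of \<open>- g ln g\<close>, which is bounded because \<open>0 \<le> g \<le> 1\<close>. The computation is done
  with the nonnegative integral since integrability is the claim.\<close>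
lemma (in finite_measure) integrable_indicator_ln_cond_exp:
  assumes F: "subalgebra M F" and A[measurable]: "A \<in> sets M"
  shows "integrable M (\<lambda>x. indicator A x * ln (real_cond_exp M F (indicator A) x))"
proof -
  interpret sigma_finite_subalgebra M F by (rule finite_measure_sigma_finite_subalgebra[OF F])
  define g where "g = (real_cond_exp M F (indicator A) :: 'a \<Rightarrow> real)"
  let ?n = "nn_cond_exp M F (indicator A)"
  have [measurable]: "g \<in> borel_measurable F" "g \<in> borel_measurable M" by (auto simp: g_def)
  have g01: "AE x in M. 0 \<le> g x \<and> g x \<le> 1"
    using cond_exp_indicator(1,2)[OF F A] by (auto simp: g_def)
  have "AE x in M. ?n x \<le> nn_cond_exp M F (\<lambda>_. 1) x"
    by (rule nn_cond_exp_mono) (auto simp: indicator_def)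
  moreover have "AE x in M. 1 = nn_cond_exp M F (\<lambda>_. 1) x"
    by (rule nn_cond_exp_F_meas) auto
  moreover have "AE x in M. nn_cond_exp M F (\<lambda>x. ennreal (- indicator A x)) x = nn_cond_exp M F (\<lambda>_. 0) x"
    by (rule nn_cond_exp_cong) (auto simp: ennreal_neg)
  moreover have "AE x in M. 0 = nn_cond_exp M F (\<lambda>_. 0) x"
    by (rule nn_cond_exp_F_meas) auto
  \<comment> \<open>The real conditional expectation is defined by subtracting and truncating the nonnegative ones. For an
    indicator neither operation changes the value: the negative part is \<open>0\<close> and the positive part is at most \<open>1\<close>.\<close>
  ultimately have n: "AE x in M. ?n x = ennreal (g x)"
  proof eventually_elim
    case (elim x)
    then have "?n x \<le> 1" by simp
    then have "?n x < top" using le_less_trans ennreal_one_less_top by blast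
    then show ?case using elim(3) elim(4)[symmetric]
      by (simp add: g_def real_cond_exp_def ennreal_indicator)
  qed
  have "(\<integral>\<^sup>+x. ennreal (norm (indicator A x * ln (g x))) \<partial>M) = (\<integral>\<^sup>+x. ennreal (- ln (g x)) * indicator A x \<partial>M)"
    using g01
  proof (intro nn_integral_cong_AE, eventually_elim)
    case (elim x)
    then have "ln (g x) \<le> 0" by (cases "g x = 0") auto
    then show ?case by (simp add: indicator_def)
  qed
  also have "\<dots> = (\<integral>\<^sup>+x. ennreal (- ln (g x)) * ?n x \<partial>M)"
    by (rule nn_cond_exp_intg[symmetric]) auto
  also have "\<dots> \<le> (\<integral>\<^sup>+x. 1 \<partial>M)"
    using n g01
  proof (intro nn_integral_mono_AE, eventually_elim)
    case (elim x)
    have "- ln (g x) * g x \<le> 1"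
    proof (cases "g x = 0")
      case False
      then have "0 < g x" using elim by simp
      \<comment> \<open>This is \<open>ln y \<le> y - 1\<close> for \<open>y = 1 / g x\<close>.\<close>
      then have "- ln (g x) \<le> 1 / g x - 1" using ln_le_minus_one[of "1 / g x"] by (simp add: ln_div)
      then have "- ln (g x) * g x \<le> (1 / g x - 1) * g x" using elim by (intro mult_right_mono) auto
      also have "\<dots> \<le> 1" using \<open>0 < g x\<close> by (simp add: field_simps)
      finally show ?thesis .
    qed simp
    then show ?case using elim
      by (simp add: ennreal_mult''[symmetric] ennreal_le_1)
  qed
  also have "\<dots> < \<infinity>" by (simp add: emeasure_eq_measure)
  finally show ?thesis unfolding g_def[symmetric] by (intro integrableI_bounded) auto
qed

lemma (in finite_measure) integrable_cond_information:
  assumes "subalgebra M F" "finite_measurable_partition M \<xi>"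
  shows "integrable M (cond_information M \<xi> F)"
  unfolding cond_information_def [abs_def]
  by (intro integrable_minus Bochner_Integration.integrable_sum integrable_indicator_ln_cond_exp assms
      finite_measurable_partitionD(5)[OF assms(2)])

section \<open>Continuity of rational maps on the Riemann sphere\<close>

text \<open>A chord has length \<open>2 sin(d/2)\<close> when its arc has length \<open>d\<close>.\<close>
lemma chordal_le_spherical: "dist (stereographic x) (stereographic y) \<le> dist x y"
proof -
  let ?s = "stereographic x" and ?t = "stereographic y" and ?d = "dist x y"
  have b: "\<bar>?s \<bullet> ?t\<bar> \<le> 1"
    using Cauchy_Schwarz_ineq2[of ?s ?t] by (simp add: norm_stereographic)
  have "?s \<bullet> ?s = 1" "?t \<bullet> ?t = 1"
    by (simp_all add: norm_stereographic flip: power2_norm_eq_inner)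
  then have "(dist ?s ?t)\<^sup>2 = 2 - 2 * (?s \<bullet> ?t)"
    by (simp add: dist_norm power2_norm_eq_inner inner_diff_left inner_diff_right inner_commute)
  also have "?s \<bullet> ?t = cos (2 * (?d / 2))"
    using b by (simp add: dist_riemann_sphere_def cos_arccos_abs)
  also have "2 - 2 * cos (2 * (?d / 2)) = (2 * sin (?d / 2))\<^sup>2"
    unfolding cos_double_sin by (simp add: power2_eq_square)
  finally have "dist ?s ?t = \<bar>2 * sin (?d / 2)\<bar>"
    by (metis power2_eq_iff_nonneg abs_ge_zero power2_abs zero_le_dist)
  also have "\<dots> \<le> ?d"
    using abs_sin_x_le_abs_x[of "?d / 2"] by (simp add: abs_mult)
  finally show ?thesis .
qed

lemma continuous_on_stereographic [continuous_intros]: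
  assumes "continuous_on S g"
  shows "continuous_on S (\<lambda>x. stereographic (g x))"
proof -
  have "continuous_on UNIV stereographic"
    unfolding continuous_on_iff using chordal_le_spherical by (meson le_less_trans)
  then show ?thesis using assms by (rule continuous_on_compose2) auto
qed

text \<open>The spherical distance is a continuous function of the two points of the unit sphere, so a map into the
  Riemann sphere may be tested in the ambient Euclidean space.\<close>
lemma continuous_on_if_stereographic:
  fixes g :: "'a::topological_space \<Rightarrow> riemann_sphere"
  assumes g: "continuous_on S (\<lambda>x. stereographic (g x))"
  shows "continuous_on S g"
  unfolding continuous_on_def
proof
  fix x assume x: "x \<in> S"
  have "\<bar>stereographic a \<bullet> stereographic b\<bar> \<le> 1" for a b
    using Cauchy_Schwarz_ineq2[of "stereographic a" "stereographic b"] by (simp add: norm_stereographic)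
  then have "-1 \<le> stereographic a \<bullet> stereographic b \<and> stereographic a \<bullet> stereographic b \<le> 1" for a b
    by (simp add: abs_le_iff minus_le_iff)
  then have "continuous_on S (\<lambda>y. dist (g y) (g x))"
    unfolding dist_riemann_sphere_def by (intro continuous_intros g) auto
  then have "((\<lambda>y. dist (g y) (g x)) \<longlongrightarrow> dist (g x) (g x)) (at x within S)"
    using x by (simp only: continuous_on_def)
  then show "(g \<longlongrightarrow> g x) (at x within S)"
    by (subst tendsto_dist_iff) simp
qed

text \<open>The point \<open>[a : b]\<close> of the complex projective line.\<close>
definition of_homogeneous :: "complex \<Rightarrow> complex \<Rightarrow> riemann_sphere" where
  "of_homogeneous a b = (if b = 0 then Infty else Fin (a / b))"

text \<open>In homogeneous coordinates the embedding into the unit sphere is given by a single formula, with no case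
  distinction at infinity. Continuity is read off from it.\<close>
lemma stereographic_of_homogeneous:
  assumes "a \<noteq> 0 \<or> b \<noteq> 0"
  shows "stereographic (of_homogeneous a b) =
    ((2 / ((cmod a)\<^sup>2 + (cmod b)\<^sup>2)) *\<^sub>R (a * cnj b),
     ((cmod a)\<^sup>2 - (cmod b)\<^sup>2) / ((cmod a)\<^sup>2 + (cmod b)\<^sup>2))"
proof (cases "b = 0")
  case True
  then show ?thesis using assms by (simp add: of_homogeneous_def)
next
  case False
  define s t where "s = (cmod a)\<^sup>2" and "t = (cmod b)\<^sup>2"
  have t: "t > 0" and s: "s \<ge> 0" using False by (auto simp: s_def t_def)
  have eq: "(cmod (a / b))\<^sup>2 = s / t"
    by (simp add: norm_divide power_divide s_def t_def)
  have c: "a / b = a * cnj b / of_real t"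
  proof -
    have "of_real t = b * cnj b" unfolding t_def by (rule complex_norm_square)
    then show ?thesis using False by simp
  qed
  have "1 + s / t = (s + t) / t" using t by (simp add: field_simps)
  then have "2 / (1 + s / t) / t = 2 / (s + t)" using t by simp
  moreover have "(2 / (1 + s / t)) *\<^sub>R (a / b) = (2 / (1 + s / t) / t) *\<^sub>R (a * cnj b)"
    unfolding c by (simp add: scaleR_conv_of_real)
  ultimately have 1: "(2 / (1 + (cmod (a / b))\<^sup>2)) *\<^sub>R (a / b) = (2 / (s + t)) *\<^sub>R (a * cnj b)"
    by (simp only: eq)
  have 2: "((cmod (a / b))\<^sup>2 - 1) / ((cmod (a / b))\<^sup>2 + 1) = (s - t) / (s + t)"
  proof -
    have "s / t - 1 = (s - t) / t" "s / t + 1 = (s + t) / t" using t by (simp_all add: field_simps)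
    then show ?thesis unfolding eq using t by simp
  qed
  show ?thesis
    using False 1 2 by (simp add: of_homogeneous_def s_def t_def)
qed

lemma continuous_on_of_homogeneous:
  assumes a: "continuous_on S a" and b: "continuous_on S b"
    and nz: "\<And>x. x \<in> S \<Longrightarrow> a x \<noteq> 0 \<or> b x \<noteq> 0"
  shows "continuous_on S (\<lambda>x. of_homogeneous (a x) (b x))"
proof -
  have pos: "(cmod (a x))\<^sup>2 + (cmod (b x))\<^sup>2 \<noteq> 0" if "x \<in> S" for x
    using nz[OF that] by (simp add: add_nonneg_eq_0_iff)
  have "continuous_on S (\<lambda>x. ((2 / ((cmod (a x))\<^sup>2 + (cmod (b x))\<^sup>2)) *\<^sub>R (a x * cnj (b x)),
     ((cmod (a x))\<^sup>2 - (cmod (b x))\<^sup>2) / ((cmod (a x))\<^sup>2 + (cmod (b x))\<^sup>2)))"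
    using pos by (intro continuous_intros a b) auto
  then have "continuous_on S (\<lambda>x. stereographic (of_homogeneous (a x) (b x)))"
    by (rule continuous_on_eq) (rule stereographic_of_homogeneous[OF nz, symmetric])
  then show ?thesis by (rule continuous_on_if_stereographic)
qed

text \<open>Each chart inverts the stereographic embedding by a formula whose denominator vanishes only at the point
  left out.\<close>
lemma continuous_on_chart:
  "continuous_on (- {Infty}) (chart (Fin 0))" "continuous_on (- {Fin 0}) (chart Infty)"
proof -
  have pos: "1 + (cmod z)\<^sup>2 > 0" "1 + (cmod z)\<^sup>2 \<noteq> 0" for z
    by (smt (verit) zero_le_power2)+
  have minus: "1 - ((cmod z)\<^sup>2 - 1) / ((cmod z)\<^sup>2 + 1) = 2 / (1 + (cmod z)\<^sup>2)"
    and plus: "1 + ((cmod z)\<^sup>2 - 1) / ((cmod z)\<^sup>2 + 1) = 2 * (cmod z)\<^sup>2 / (1 + (cmod z)\<^sup>2)" for z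
    using pos[of z] by (simp_all add: field_simps)
  have n0: "1 - snd (stereographic x) \<noteq> 0" if "x \<noteq> Infty" for x
    using that pos by (cases x) (auto simp: minus)
  have "continuous_on (- {Infty}) (\<lambda>x. (1 / (1 - snd (stereographic x))) *\<^sub>R fst (stereographic x))"
    using n0 by (intro continuous_intros) auto
  then show "continuous_on (- {Infty}) (chart (Fin 0))"
  proof (rule continuous_on_eq)
    fix x assume "x \<in> - {Infty}"
    then show "(1 / (1 - snd (stereographic x))) *\<^sub>R fst (stereographic x) = chart (Fin 0) x"
    proof (cases x)
      case (Fin z)
      have "1 / (2 / (1 + (cmod z)\<^sup>2)) * (2 / (1 + (cmod z)\<^sup>2)) = 1" using pos(2)[of z] by simp
      then show ?thesis
        by (simp only: Fin stereographic.simps fst_conv snd_conv minus scaleR_scaleR)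
          (simp add: chart_def)
    qed (use \<open>x \<in> - {Infty}\<close> in simp)
  qed
  have quot: "1 / (2 * s / k) * (2 / k) = 1 / s" if "s \<noteq> 0" "k \<noteq> 0" for s k :: real
    using that by (simp add: field_simps)
  have p0: "1 + snd (stereographic x) \<noteq> 0" if "x \<noteq> Fin 0" for x
    using that pos by (cases x) (auto simp: plus)
  have "continuous_on (- {Fin 0}) (\<lambda>x. (1 / (1 + snd (stereographic x))) *\<^sub>R cnj (fst (stereographic x)))"
    using p0 by (intro continuous_intros) auto
  then show "continuous_on (- {Fin 0}) (chart Infty)"
  proof (rule continuous_on_eq)
    fix x assume x: "x \<in> - {Fin 0}"
    show "(1 / (1 + snd (stereographic x))) *\<^sub>R cnj (fst (stereographic x)) = chart Infty x"
    proof (cases x)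
      case (Fin z)
      then have z: "z \<noteq> 0" using x by auto
      have "(1 / (1 + snd (stereographic x))) *\<^sub>R cnj (fst (stereographic x)) = (1 / (cmod z)\<^sup>2) *\<^sub>R cnj z"
      proof -
        have "1 / (2 * (cmod z)\<^sup>2 / (1 + (cmod z)\<^sup>2)) * (2 / (1 + (cmod z)\<^sup>2)) = 1 / (cmod z)\<^sup>2"
          using z pos(2)[of z] by (intro quot) simp_all
        then show ?thesis
          by (simp only: Fin stereographic.simps fst_conv snd_conv plus complex_cnj_scaleR scaleR_scaleR)
      qed
      also have "\<dots> = 1 / z"
        using z by (simp add: scaleR_conv_of_real complex_norm_square del: of_real_power)
      finally show ?thesis by (simp add: chart_def Fin)
    qed (simp add: chart_def)
  qed
qed

text \<open>The degree-\<open>d\<close> homogenisation of \<open>P\<close> evaluated at \<open>[1 : w]\<close>. The degree \<open>d\<close> is a parameter because the numerator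
  and the denominator of a rational function have to be homogenised in the same degree.\<close>
definition reversed_poly :: "nat \<Rightarrow> complex poly \<Rightarrow> complex \<Rightarrow> complex" where
  "reversed_poly d P w = (\<Sum>i\<le>d. coeff P i * w ^ (d - i))"

lemma reversed_poly_nonzero:
  assumes "degree P \<le> d" "w \<noteq> 0"
  shows "reversed_poly d P w = w ^ d * poly P (1 / w)"
proof -
  have "poly P (1 / w) = (\<Sum>i\<le>d. coeff P i * (1 / w) ^ i)"
    unfolding poly_altdef
    by (rule sum.mono_neutral_left) (use assms(1) in \<open>auto simp: not_le coeff_eq_0\<close>)
  then show ?thesis
    using assms(2)
    by (auto simp: reversed_poly_def sum_distrib_left power_diff power_one_over field_simps intro!: sum.cong)
qed

lemma reversed_poly_0: "reversed_poly d P 0 = coeff P d"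
proof -
  have "reversed_poly d P 0 = (\<Sum>i\<in>{d}. coeff P i * 0 ^ (d - i))"
    unfolding reversed_poly_def by (rule sum.mono_neutral_right) auto
  then show ?thesis by simp
qed

text \<open>In each of the two charts a rational map is \<open>[P : Q]\<close> for polynomials \<open>P\<close>, \<open>Q\<close> without common zero:
  coprimality excludes common zeros in the plane, and at infinity the coefficients of degree
  \<open>max (degree P) (degree Q)\<close> do not both vanish. The two chart domains are open and cover the sphere.\<close>
lemma rational_map_continuous:
  assumes "rational_map \<phi>"
  shows "continuous_on UNIV \<phi>"
proof -
  obtain P Q where Q: "Q \<noteq> 0" and cop: "coprime P Q" and \<phi>: "\<phi> = ratio_map P Q"
    using assms by (auto simp: rational_map_def)
  have root: "poly P z \<noteq> 0 \<or> poly Q z \<noteq> 0" for z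
    using coprime_poly_0[OF cop, of z] by simp
  define d where "d = max (degree P) (degree Q)"
  have d: "degree P \<le> d" "degree Q \<le> d" by (auto simp: d_def)
  have "continuous_on (- {Infty}) (\<lambda>x. of_homogeneous (poly P (chart (Fin 0) x)) (poly Q (chart (Fin 0) x)))"
    using root by (intro continuous_on_of_homogeneous continuous_intros continuous_on_chart) auto
  then have 1: "continuous_on (- {Infty}) \<phi>"
  proof (rule continuous_on_eq)
    fix x assume "x \<in> - {Infty}"
    then show "of_homogeneous (poly P (chart (Fin 0) x)) (poly Q (chart (Fin 0) x)) = \<phi> x"
      by (cases x) (auto simp: \<phi> chart_def of_homogeneous_def)
  qed
  have top: "coeff P d \<noteq> 0 \<or> coeff Q d \<noteq> 0"
    using Q by (cases "degree P \<le> degree Q") (auto simp: d_def max_def)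
  have nz: "reversed_poly d P w \<noteq> 0 \<or> reversed_poly d Q w \<noteq> 0" for w
    using top root[of "1 / w"] by (cases "w = 0") (auto simp: reversed_poly_0 reversed_poly_nonzero d)
  have "continuous_on (- {Fin 0})
      (\<lambda>x. of_homogeneous (reversed_poly d P (chart Infty x)) (reversed_poly d Q (chart Infty x)))"
    using nz unfolding reversed_poly_def
    by (intro continuous_on_of_homogeneous continuous_intros continuous_on_chart) auto
  then have 2: "continuous_on (- {Fin 0}) \<phi>"
  proof (rule continuous_on_eq)
    fix x assume x: "x \<in> - {Fin 0}"
    show "of_homogeneous (reversed_poly d P (chart Infty x)) (reversed_poly d Q (chart Infty x)) = \<phi> x"
    proof (cases x)
      case (Fin z)
      with x have "1 / z \<noteq> 0" by auto
      then show ?thesis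
        by (simp add: \<phi> Fin chart_def of_homogeneous_def reversed_poly_nonzero d)
    next
      case Infty
      have "degree P > degree Q \<longleftrightarrow> coeff Q d = 0"
        using Q by (auto simp: d_def max_def coeff_eq_0)
      moreover have "degree P \<le> degree Q \<Longrightarrow> d = degree Q" by (simp add: d_def)
      ultimately show ?thesis
        by (auto simp: \<phi> Infty chart_def of_homogeneous_def reversed_poly_0)
    qed
  qed
  have "- {Infty} \<union> - {Fin 0} = UNIV" by auto
  then show ?thesis
    using continuous_on_open_Un[OF _ _ 1 2] by (simp add: open_Compl)
qed

section \<open>Forward invariance of the Julia set of the skew product\<close>

lemma fibre_iterate_left_shift:
  "fibre_iterate f \<omega> (Suc n) = fibre_iterate f (left_shift \<omega>) n \<circ> f (\<omega> 1)"
proof (induction n)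
  case (Suc n)
  have "fibre_iterate f \<omega> (Suc (Suc n)) = f (\<omega> (int (Suc (Suc n)))) \<circ> fibre_iterate f \<omega> (Suc n)"
    by simp
  also have "\<dots> = f (left_shift \<omega> (int (Suc n))) \<circ> fibre_iterate f (left_shift \<omega>) n \<circ> f (\<omega> 1)"
    unfolding Suc.IH by (simp add: left_shift_def o_assoc add.commute)
  finally show ?case by simp
qed simp

lemma normal_family_pullback:
  fixes g :: "'a::metric_space \<Rightarrow> 'b::metric_space" and \<F> :: "('b \<Rightarrow> 'c::metric_space) set"
  assumes g: "continuous_on UNIV g" and \<F>: "normal_family \<F> V"
  shows "normal_family ((\<lambda>\<psi>. \<psi> \<circ> g) ` \<F>) (g -` V)"
  unfolding normal_family_def
proof (intro allI impI)
  fix \<phi> :: "nat \<Rightarrow> 'a \<Rightarrow> 'c" assume "range \<phi> \<subseteq> (\<lambda>\<psi>. \<psi> \<circ> g) ` \<F>"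
  then have "\<forall>n. \<exists>\<psi>\<in>\<F>. \<phi> n = \<psi> \<circ> g" by blast
  then obtain \<psi> where \<psi>: "\<And>n. \<psi> n \<in> \<F>" "\<And>n. \<phi> n = \<psi> n \<circ> g" by metis
  then have "range \<psi> \<subseteq> \<F>" by auto
  from \<F>[unfolded normal_family_def, THEN spec, THEN mp, OF this]
  obtain r h where r: "strict_mono r"
    and h: "\<forall>K. compact K \<and> K \<subseteq> V \<longrightarrow> uniform_limit K (\<psi> \<circ> r) h sequentially"
    by (elim exE conjE)
  have "uniform_limit K (\<phi> \<circ> r) (h \<circ> g) sequentially" if K: "compact K" "K \<subseteq> g -` V" for K
  proof -
    have "compact (g ` K)"
      using K(1) g by (meson compact_continuous_image continuous_on_subset subset_UNIV)
    then have "uniform_limit (g ` K) (\<psi> \<circ> r) h sequentially"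
      using K(2) by (intro h[THEN spec, THEN mp]) auto
    then show ?thesis by (simp add: uniform_limit_iff \<psi>(2))
  qed
  then show "\<exists>r h. strict_mono r \<and> (\<forall>K. compact K \<and> K \<subseteq> g -` V \<longrightarrow> uniform_limit K (\<phi> \<circ> r) h sequentially)"
    using r by blast
qed

text \<open>A sequence in the larger family either takes the value \<open>g\<close> infinitely often, which gives a constant
  subsequence, or has a subsequence in \<open>\<F>\<close>.\<close>
lemma normal_family_insert:
  assumes \<F>: "normal_family \<F> U"
  shows "normal_family (insert g \<F>) U"
  unfolding normal_family_def
proof (intro allI impI)
  fix \<phi> :: "nat \<Rightarrow> 'a \<Rightarrow> 'b" assume \<phi>: "range \<phi> \<subseteq> insert g \<F>"
  show "\<exists>r h. strict_mono r \<and> (\<forall>K. compact K \<and> K \<subseteq> U \<longrightarrow> uniform_limit K (\<phi> \<circ> r) h sequentially)"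
  proof (cases "infinite {n. \<phi> n = g}")
    case True
    then obtain r :: "nat \<Rightarrow> nat" where r: "strict_mono r" "\<And>n. \<phi> (r n) = g"
      using infinite_enumerate[of "{n. \<phi> n = g}"] by auto
    then have "uniform_limit K (\<phi> \<circ> r) g sequentially" for K
      by (simp add: uniform_limit_iff)
    then show ?thesis using r(1) by blast
  next
    case False
    then have "infinite {n. \<phi> n \<noteq> g}"
      using finite_Collect_not by blast
    then obtain r :: "nat \<Rightarrow> nat" where r: "strict_mono r" "\<And>n. \<phi> (r n) \<noteq> g"
      using infinite_enumerate[of "{n. \<phi> n \<noteq> g}"] by auto
    then have "range (\<phi> \<circ> r) \<subseteq> \<F>" using \<phi> by auto
    from \<F>[unfolded normal_family_def, THEN spec, THEN mp, OF this]
    obtain r' h where r': "strict_mono r'"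
      and h: "\<forall>K. compact K \<and> K \<subseteq> U \<longrightarrow> uniform_limit K (\<phi> \<circ> r \<circ> r') h sequentially"
      by (elim exE conjE)
    have "strict_mono (r \<circ> r')" using r(1) r' by (rule strict_mono_o)
    then show ?thesis
      using h by (intro exI[of _ "r \<circ> r'"] exI[of _ h]) (auto simp: o_assoc)
  qed
qed

text \<open>The iterates along \<open>\<omega>\<close> are \<open>f (\<omega> 1)\<close> and the iterates along the shifted sequence composed with \<open>f (\<omega> 1)\<close>.
  So normality near \<open>f (\<omega> 1) z\<close> along the shifted sequence pulls back to normality near \<open>z\<close> along \<open>\<omega>\<close>.\<close>
lemma fibre_julia_forward:
  assumes g: "continuous_on UNIV (f (\<omega> 1))" and z: "z \<in> fibre_julia f \<omega>"
  shows "f (\<omega> 1) z \<in> fibre_julia f (left_shift \<omega>)"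
proof (rule ccontr)
  let ?g = "f (\<omega> 1)" and ?F = "{fibre_iterate f (left_shift \<omega>) n | n. n \<ge> 1}"
  assume "?g z \<notin> fibre_julia f (left_shift \<omega>)"
  then obtain V where V: "open V" "?g z \<in> V" "normal_family ?F V"
    unfolding fibre_julia_def julia_of_def by blast
  have "{fibre_iterate f \<omega> n | n. n \<ge> 1} \<subseteq> insert ?g ((\<lambda>\<psi>. \<psi> \<circ> ?g) ` ?F)"
  proof clarify
    fix n :: nat assume "n \<ge> 1" and no: "fibre_iterate f \<omega> n \<notin> (\<lambda>\<psi>. \<psi> \<circ> ?g) ` ?F"
    then obtain k where k: "n = Suc k" by (cases n) auto
    have "k = 0"
    proof (rule ccontr)
      assume "k \<noteq> 0"
      then have "fibre_iterate f (left_shift \<omega>) k \<in> ?F" by auto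
      then show False using no unfolding k fibre_iterate_left_shift by blast
    qed
    then show "fibre_iterate f \<omega> n = ?g" by (simp add: k)
  qed
  moreover have "normal_family (insert ?g ((\<lambda>\<psi>. \<psi> \<circ> ?g) ` ?F)) (?g -` V)"
    by (intro normal_family_insert normal_family_pullback g V)
  ultimately have "normal_family {fibre_iterate f \<omega> n | n. n \<ge> 1} (?g -` V)"
    unfolding normal_family_def by (meson order_trans)
  moreover have "open (?g -` V)" using g V(1) by (rule open_vimage[rotated])
  ultimately show False
    using z V(2) unfolding fibre_julia_def julia_of_def by blast
qed

lemma Sigma_seq_range: "\<omega> \<in> Sigma_seq m \<Longrightarrow> \<omega> i \<in> {1..m}"
  unfolding Sigma_seq_def by blast

lemma closed_Sigma_seq: "closed (Sigma_seq m)"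
proof -
  have "Sigma_seq m = (\<Inter>i. (\<lambda>\<omega>. \<omega> i) -` {1..m})" by (auto simp: Sigma_seq_def)
  moreover have "closed ((\<lambda>\<omega> :: int \<Rightarrow> nat. \<omega> i) -` {1..m})" for i
    by (intro closed_vimage continuous_intros) auto
  ultimately show ?thesis by auto
qed

lemma skew_julia_subset: "skew_julia m f \<subseteq> Sigma_seq m \<times> UNIV"
  unfolding skew_julia_def
  by (rule closure_minimal) (auto intro: closed_Times closed_Sigma_seq)

text \<open>The coordinate \<open>\<omega> 1\<close> is locally constant, so locally only one of the maps \<open>f j\<close> is involved.\<close>
lemma continuous_on_skew_product:
  assumes "\<And>j. j \<in> {1..m} \<Longrightarrow> continuous_on UNIV (f j)"
  shows "continuous_on (Sigma_seq m \<times> UNIV) (skew_product f)"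
proof -
  have "continuous_on UNIV (\<lambda>x :: skew_point. left_shift (fst x))"
    unfolding left_shift_def
  proof (rule continuous_on_coordinatewise_then_product)
    fix i :: int
    have "continuous_on UNIV (\<lambda>x :: skew_point. fst x)" by (intro continuous_intros)
    then show "continuous_on UNIV (\<lambda>x :: skew_point. fst x (i + 1))"
      by (rule continuous_on_product_then_coordinatewise)
  qed
  then have 1: "continuous_on (Sigma_seq m \<times> UNIV) (\<lambda>x :: skew_point. left_shift (fst x))"
    by (rule continuous_on_subset) simp
  have 2: "continuous_on (Sigma_seq m \<times> UNIV) (\<lambda>x. f (fst x 1) (snd x))"
  proof (subst continuous_on_def, rule ballI)
    fix x :: skew_point assume x: "x \<in> Sigma_seq m \<times> UNIV"
    let ?j = "fst x 1"
    have "?j \<in> {1..m}" using x by (intro Sigma_seq_range) auto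
    then have "continuous_on UNIV (\<lambda>y :: skew_point. f ?j (snd y))"
      by (intro continuous_on_compose2[OF assms] continuous_intros) auto
    then have lim: "((\<lambda>y. f ?j (snd y)) \<longlongrightarrow> f ?j (snd x)) (at x within Sigma_seq m \<times> UNIV)"
      by (meson UNIV_I continuous_on_def tendsto_within_subset subset_UNIV)
    have "continuous_on UNIV (\<lambda>y :: skew_point. fst y 1)"
      by (rule continuous_on_product_then_coordinatewise) (intro continuous_intros)
    then have "open ((\<lambda>y :: skew_point. fst y 1) -` {?j})"
      by (intro open_vimage) (auto simp: discrete_topology_class.open_discrete)
    then have "\<forall>\<^sub>F y in at x within Sigma_seq m \<times> UNIV. y \<in> (\<lambda>y. fst y 1) -` {?j}"
      unfolding eventually_at_topological by (intro exI[of _ "(\<lambda>y. fst y 1) -` {?j}"]) auto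
    then have "\<forall>\<^sub>F y in at x within Sigma_seq m \<times> UNIV. f ?j (snd y) = f (fst y 1) (snd y)"
      by eventually_elim auto
    then show "((\<lambda>y. f (fst y 1) (snd y)) \<longlongrightarrow> f ?j (snd x)) (at x within Sigma_seq m \<times> UNIV)"
      using lim by (rule Lim_transform_eventually[rotated])
  qed
  show ?thesis
    using continuous_on_Pair[OF 1 2] by (simp add: skew_product_def[abs_def])
qed

text \<open>Continuity extends the invariance of the fibre Julia sets to the closure of their union.\<close>
lemma skew_julia_forward:
  assumes f: "\<And>j. j \<in> {1..m} \<Longrightarrow> continuous_on UNIV (f j)"
  shows "skew_product f ` skew_julia m f \<subseteq> skew_julia m f"
  unfolding skew_julia_def
proof (rule image_closure_subset)
  show "continuous_on (closure (\<Union>\<omega>\<in>Sigma_seq m. {\<omega>} \<times> fibre_julia f \<omega>)) (skew_product f)"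
    using continuous_on_skew_product[OF f] skew_julia_subset[of m f]
    unfolding skew_julia_def by (rule continuous_on_subset)
  show "skew_product f ` (\<Union>\<omega>\<in>Sigma_seq m. {\<omega>} \<times> fibre_julia f \<omega>)
      \<subseteq> closure (\<Union>\<omega>\<in>Sigma_seq m. {\<omega>} \<times> fibre_julia f \<omega>)"
  proof (rule order_trans[OF _ closure_subset], rule image_subsetI)
    fix x assume "x \<in> (\<Union>\<omega>\<in>Sigma_seq m. {\<omega>} \<times> fibre_julia f \<omega>)"
    then obtain \<omega> z where x: "x = (\<omega>, z)" and \<omega>: "\<omega> \<in> Sigma_seq m" and z: "z \<in> fibre_julia f \<omega>"
      by blast
    have "left_shift \<omega> \<in> Sigma_seq m" using \<omega> by (auto simp: Sigma_seq_def left_shift_def)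
    moreover have "f (\<omega> 1) z \<in> fibre_julia f (left_shift \<omega>)"
      using \<omega> z by (intro fibre_julia_forward f Sigma_seq_range)
    ultimately show "skew_product f x \<in> (\<Union>\<omega>\<in>Sigma_seq m. {\<omega>} \<times> fibre_julia f \<omega>)"
      by (simp add: x skew_product_def)
  qed
qed simp

section \<open>Adapted partitions\<close>

text \<open>A continuous injection of a compact set is a homeomorphism onto its compact image, so the image of a Borel
  subset is the preimage of a Borel set under the continuous inverse.\<close>
lemma borel_image_inj_on_compact:
  fixes g :: "'a::topological_space \<Rightarrow> 'b::t2_space"
  assumes K: "compact K" "continuous_on K g" "inj_on g K" and B: "B \<in> sets borel"
  shows "g ` (B \<inter> K) \<in> sets borel"
proof -
  let ?h = "the_inv_into K g"
  have "continuous_on (g ` K) ?h"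
    using K by (intro continuous_on_inv) (auto simp: the_inv_into_f_f)
  then have "?h \<in> borel_measurable (restrict_space borel (g ` K))"
    by (rule borel_measurable_continuous_on_restrict)
  then have "?h -` B \<inter> g ` K \<in> sets (restrict_space borel (g ` K))"
    using measurable_sets[of ?h "restrict_space borel (g ` K)" borel B] B
    by (simp add: space_restrict_space)
  moreover have "g ` K \<in> sets borel"
    using compact_continuous_image[OF K(2,1)] by (intro borel_closed compact_imp_closed)
  moreover have "?h -` B \<inter> g ` K = g ` (B \<inter> K)"
    using K(3) by (auto simp: the_inv_into_f_f)
  ultimately show ?thesis by (simp add: sets_restrict_space_iff)
qed

text \<open>The two projection algebras have the same traces on every atom. From \<open>\<Q>'\<close> to \<open>\<Q>\<close> one takes the preimage of
  a Borel set under \<open>f j\<close>; from \<open>\<Q>\<close> to \<open>\<Q>'\<close> one takes the image of its part in \<open>K\<close>, which is Borel because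
  \<open>f j\<close> is injective on the compact set \<open>K\<close>.\<close>
lemma Pi_adapted_join_eq:
  assumes cont: "\<And>j. j \<in> {1..m} \<Longrightarrow> continuous_on UNIV (f j)"
    and R: "Pi_adapted m f \<R>" and P: "space P = skew_julia m f"
  shows "P \<squnion>\<^sub>\<sigma> pulled_projection_algebra m f \<squnion>\<^sub>\<sigma> sigma (skew_julia m f) \<R>
    = P \<squnion>\<^sub>\<sigma> projection_algebra m f \<squnion>\<^sub>\<sigma> sigma (skew_julia m f) \<R>"
proof -
  let ?J = "skew_julia m f" and ?S = "skew_product f"
  have fwd: "?S \<in> ?J \<rightarrow> ?J" using skew_julia_forward[of m f, OF cont] by auto
  have proj: "sets (projection_algebra m f) = (\<lambda>B. snd -` B \<inter> ?J) ` sets borel"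
    unfolding projection_algebra_def Setcompr_eq_image[symmetric]
    by (rule sets_vimage_algebra2) simp
  have "sets (pulled_projection_algebra m f) = (\<lambda>D. ?S -` D \<inter> ?J) ` sets (projection_algebra m f)"
    unfolding pulled_projection_algebra_def Setcompr_eq_image[symmetric]
    by (rule sets_vimage_algebra2) (use fwd in \<open>simp add: projection_algebra_def\<close>)
  moreover have "?S -` (snd -` B \<inter> ?J) \<inter> ?J = {x \<in> ?J. snd (?S x) \<in> B}" for B
    using fwd by auto
  ultimately have pull: "sets (pulled_projection_algebra m f) = (\<lambda>B. {x \<in> ?J. snd (?S x) \<in> B}) ` sets borel"
    by (simp add: proj image_image)
  have part: "finite_measurable_partition (restrict_space borel ?J) \<R>"
    using R by (simp add: Pi_adapted_def)
  have atom: "\<exists>j\<in>{1..m}. \<exists>K. compact K \<and> inj_on (f j) K \<and> (\<forall>x\<in>A. snd (?S x) = f j (snd x) \<and> snd x \<in> K)"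
    if "A \<in> \<R>" for A
  proof -
    obtain j K U where jK: "j \<in> {1..m}" "compact K" and U: "K \<subseteq> U" "inj_on (f j) U"
      and A: "A \<subseteq> ?J \<inter> ({\<omega> \<in> Sigma_seq m. \<omega> 1 = j} \<times> K)"
      using R \<open>A \<in> \<R>\<close> unfolding Pi_adapted_def by meson
    have "\<forall>x\<in>A. snd (?S x) = f j (snd x) \<and> snd x \<in> K"
      using A by (auto simp: skew_product_def)
    moreover have "inj_on (f j) K" using U(2,1) by (rule inj_on_subset)
    ultimately show ?thesis using jK by blast
  qed
  show ?thesis
  proof (rule sigma_join_partition_cong)
    show "finite \<R>" "\<Union>\<R> = ?J"
      using finite_measurable_partitionD(1,2)[OF part] by (simp_all add: space_restrict_space)
  next
    fix A D assume "A \<in> \<R>" and "D \<in> sets (pulled_projection_algebra m f)"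
    then obtain B where B: "B \<in> sets borel" and D: "D = {x \<in> ?J. snd (?S x) \<in> B}"
      using pull by blast
    from atom[OF \<open>A \<in> \<R>\<close>] obtain j where j: "j \<in> {1..m}" and A: "\<And>x. x \<in> A \<Longrightarrow> snd (?S x) = f j (snd x)"
      by blast
    have "f j -` B \<in> sets borel"
      using measurable_sets[OF borel_measurable_continuous_onI[OF cont[OF j]] B] by simp
    then have "snd -` (f j -` B) \<inter> ?J \<in> sets (projection_algebra m f)"
      unfolding proj by blast
    moreover have "D \<inter> A = (snd -` (f j -` B) \<inter> ?J) \<inter> A"
      using A by (auto simp: D)
    ultimately show "\<exists>E\<in>sets (projection_algebra m f). D \<inter> A = E \<inter> A" by blast
  next
    fix A E assume "A \<in> \<R>" and "E \<in> sets (projection_algebra m f)"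
    then obtain B where B: "B \<in> sets borel" and E: "E = snd -` B \<inter> ?J"
      using proj by blast
    from atom[OF \<open>A \<in> \<R>\<close>] obtain j K where j: "j \<in> {1..m}" and K: "compact K" "inj_on (f j) K"
      and A: "\<And>x. x \<in> A \<Longrightarrow> snd (?S x) = f j (snd x)" "\<And>x. x \<in> A \<Longrightarrow> snd x \<in> K"
      by blast
    have "f j ` (B \<inter> K) \<in> sets borel"
      using K B continuous_on_subset[OF cont[OF j]] by (intro borel_image_inj_on_compact) auto
    then have "{x \<in> ?J. snd (?S x) \<in> f j ` (B \<inter> K)} \<in> sets (pulled_projection_algebra m f)"
      unfolding pull by blast
    moreover have "E \<inter> A = {x \<in> ?J. snd (?S x) \<in> f j ` (B \<inter> K)} \<inter> A"
    proof -
      have "snd (?S x) \<in> f j ` (B \<inter> K) \<longleftrightarrow> snd x \<in> B" if "x \<in> A" for x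
        using A[OF that] inj_on_image_mem_iff[OF K(2), of "snd x" "B \<inter> K"] by simp
      then show ?thesis unfolding E by blast
    qed
    ultimately show "\<exists>D\<in>sets (pulled_projection_algebra m f). E \<inter> A = D \<inter> A" by blast
  qed (simp_all add: P pulled_projection_algebra_def projection_algebra_def)
qed

theorem proposition1p4:
  fixes m :: nat
    and f :: "nat \<Rightarrow> riemann_sphere \<Rightarrow> riemann_sphere"
    and p :: "skew_point \<Rightarrow> int \<Rightarrow> nat"
    and \<mu> :: "skew_point measure"
    and \<R>1 \<R>2 :: "skew_point set set"
  assumes "m \<ge> 1"
    and "\<And>j. j \<in> {1..m} \<Longrightarrow> rational_map (f j) \<and> \<not> f j constant_on UNIV"
    and "expanding m f"
    and "p \<in> restrict_space borel (skew_julia m f) \<rightarrow>\<^sub>M restrict_space borel (Sigma_seq m)"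
    and "\<And>x. x \<in> skew_julia m f \<Longrightarrow> left_shift (p x) = p (skew_product f x)"
    and "prob_space \<mu>"
    and "sets \<mu> = sets (restrict_space borel (skew_julia m f))"
    and "\<And>A. A \<in> sets \<mu> \<Longrightarrow>
           emeasure \<mu> (skew_product f -` A \<inter> skew_julia m f) = emeasure \<mu> A"
    and "Pi_adapted m f \<R>1"
    and "Pi_adapted m f \<R>2"
  shows "(AE x in \<mu>. local_projection_entropy m f p \<mu> x \<R>1 = local_projection_entropy m f p \<mu> x \<R>2)
       \<and> projection_entropy m f p \<mu> \<R>1 = projection_entropy m f p \<mu> \<R>2"
proof -
  let ?J = "skew_julia m f"
  interpret prob_space \<mu> by fact
  have cont: "continuous_on UNIV (f j)" if "j \<in> {1..m}" for j
    using assms(2)[OF that] rational_map_continuous by blast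
  have sets_\<mu> [measurable_cong]: "sets \<mu> = sets (restrict_space borel ?J)" by fact
  then have space_\<mu>: "space \<mu> = ?J"
    by (metis sets_eq_imp_space_eq space_restrict_space space_borel UNIV_I Int_UNIV_right)
  define F where "F = factor_algebra m f p"
  define Q where "Q = projection_algebra m f"
  define Q' where "Q' = pulled_projection_algebra m f"
  have meas: "g \<in> borel_measurable \<mu>" if "continuous_on ?J g" for g :: "skew_point \<Rightarrow> riemann_sphere"
    using borel_measurable_continuous_on_restrict[OF that] measurable_cong_sets[OF sets_\<mu> refl] by blast
  have "p \<in> \<mu> \<rightarrow>\<^sub>M restrict_space borel (Sigma_seq m)"
    using assms(4) measurable_cong_sets[OF sets_\<mu> refl] by blast
  then have F: "subalgebra \<mu> F"
    unfolding F_def factor_algebra_def space_\<mu>[symmetric] by (rule subalgebra_vimage_algebra)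
  have "snd \<in> borel_measurable \<mu>" by (intro meas continuous_intros)
  then have Q: "subalgebra \<mu> Q"
    unfolding Q_def projection_algebra_def space_\<mu>[symmetric] by (rule subalgebra_vimage_algebra)
  have "continuous_on ?J (skew_product f)"
    using continuous_on_skew_product[of m f, OF cont] skew_julia_subset by (rule continuous_on_subset)
  then have "(\<lambda>x. snd (skew_product f x)) \<in> borel_measurable \<mu>"
    by (intro meas continuous_intros)
  moreover have "skew_product f \<in> space \<mu> \<rightarrow> ?J"
    using skew_julia_forward[of m f, OF cont] unfolding space_\<mu> by auto
  ultimately have "skew_product f \<in> \<mu> \<rightarrow>\<^sub>M projection_algebra m f"
    unfolding projection_algebra_def by (intro measurable_vimage_algebra2)
  then have Q': "subalgebra \<mu> Q'"
    unfolding Q'_def pulled_projection_algebra_def space_\<mu>[symmetric]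
    by (rule subalgebra_vimage_algebra)
  have FQ: "subalgebra \<mu> (F \<squnion>\<^sub>\<sigma> Q)" and FQ': "subalgebra \<mu> (F \<squnion>\<^sub>\<sigma> Q')"
    using F Q Q' by (auto intro: subalgebra_sigma_join)
  have part: "finite_measurable_partition \<mu> \<R>" if "Pi_adapted m f \<R>" for \<R>
    using that sets_\<mu> space_\<mu>
    by (simp add: Pi_adapted_def finite_measurable_partition_def space_restrict_space)
  have join: "F \<squnion>\<^sub>\<sigma> Q' \<squnion>\<^sub>\<sigma> sigma (space \<mu>) \<R> = F \<squnion>\<^sub>\<sigma> Q \<squnion>\<^sub>\<sigma> sigma (space \<mu>) \<R>"
    if "Pi_adapted m f \<R>" for \<R>
    unfolding Q_def Q'_def space_\<mu>
    by (rule Pi_adapted_join_eq[of m f, OF cont that]) (simp_all add: F_def factor_algebra_def)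
  let ?D = "\<lambda>\<R> x. cond_information \<mu> \<R> (F \<squnion>\<^sub>\<sigma> Q') x - cond_information \<mu> \<R> (F \<squnion>\<^sub>\<sigma> Q) x"
  have D_meas: "?D \<R> \<in> borel_measurable \<mu>" if "Pi_adapted m f \<R>" for \<R>
    by (intro borel_measurable_diff borel_measurable_cond_information FQ FQ' part that)
  have D_eq: "AE x in \<mu>. ?D \<R>1 x = ?D \<R>2 x"
    using assms(9,10) by (intro cond_information_diff_eq FQ FQ' part join)
  have inv: "subalgebra \<mu> (invariant_algebra m f)"
  proof -
    let ?I = "{B \<in> sets (restrict_space borel ?J). skew_product f -` B \<inter> ?J = B}"
    have "?I \<subseteq> Pow ?J" by blast
    moreover have "sigma_sets ?J ?I \<subseteq> sets \<mu>"
      using sets.sigma_sets_subset[of ?I \<mu>] by (auto simp: sets_\<mu> space_\<mu>)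
    ultimately show ?thesis
      by (simp add: invariant_algebra_def subalgebra_def space_\<mu>)
  qed
  interpret I: sigma_finite_subalgebra \<mu> "invariant_algebra m f"
    by (rule finite_measure_sigma_finite_subalgebra[OF inv])
  have "AE x in \<mu>. local_projection_entropy m f p \<mu> x \<R>1 = local_projection_entropy m f p \<mu> x \<R>2"
    unfolding local_projection_entropy_def F_def[symmetric] Q_def[symmetric] Q'_def[symmetric]
    by (intro I.real_cond_exp_cong D_eq D_meas assms(9,10))
  moreover have "projection_entropy m f p \<mu> \<R> = (\<integral>x. ?D \<R> x \<partial>\<mu>)" if "Pi_adapted m f \<R>" for \<R>
    unfolding projection_entropy_def cond_entropy_def F_def[symmetric] Q_def[symmetric] Q'_def[symmetric]
    by (intro Bochner_Integration.integral_diff[symmetric] integrable_cond_information FQ FQ' part that)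
  moreover have "(\<integral>x. ?D \<R>1 x \<partial>\<mu>) = (\<integral>x. ?D \<R>2 x \<partial>\<mu>)"
    by (intro integral_cong_AE D_eq D_meas assms(9,10))
  ultimately show ?thesis using assms(9,10) by simp
qed

end
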